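(* Let $n\geq 2$ and let $\alpha:\mathcal K_{(0),b}^n\to\mathcal K_{(0),b}^n$ be an involution that is decreasing with respect to inclusion (that is, $K\subseteq L$ implies $\alpha(L)\subseteq\alpha(K)$). Then $\mathcal K_{(0),b}^n$ admits an equivariant mean with respect to $\alpha$. Moreover, $\bigl(\mathcal K_{(0),b}^n,\alpha\bigr)$ is a $\mathbb Z_2$-AR.
   Context: $\mathcal K_{(0),b}^n$ is the family of all compact convex subsets of $\mathbb R^n$ that contain the origin in their interior, equipped with the Hausdorff metric $d_H(K,L)=\max\{\sup_{x\in K}d(x,L),\sup_{y\in L}d(y,K)\}$. An involution on a space $X$ is a continuous map $\alpha:X\to X$ with $\alpha\circ\alpha=1_X$; it corresponds to an action of $\mathbb Z_2=\{-1,1\}$ with $-1\cdot x=\alpha(x)$, and $(X,\alpha)$ denotes this $\mathbb Z_2$-space. A subset $A$ is invariant if $\alpha(A)=A$; a function $f:(X,\alpha)\to(Y,\beta)$ is equivariant if $f\circ\alpha=\beta\circ f$. A mean on $X$ is a continuous map $p:X\times X\to X$ with $p(x,x)=x$ and $p(x,y)=p(y,x)$ for all $x,y$. It is equivariant with respect to $\alpha$ if $p(\alpha(x),\alpha(y))=\alpha(p(x,y))$ for all $x,y$. A metrizable $\mathbb Z_2$-space $Y$ is a $\mathbb Z_2$-AR ($\mathbb Z_2$-absolute retract) if for every metrizable $\mathbb Z_2$-space $Z$ containing $Y$ as a closed invariant subset there is a continuous equivariant retraction $Z\to Y$. *)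

theory Defs
  imports "HOL-Analysis.Analysis"
begin

(* The suprema of reals below are only meaningful for nonempty bounded sets. On all other
   arguments the distance is set to 0, so that it is nonnegative everywhere, as the locale
   Metric_space requires. This convention does not affect convex bodies. *)
definition hausdorff_dist :: "'a::metric_space set \<Rightarrow> 'a set \<Rightarrow> real" where
  "hausdorff_dist K L =
     (if K \<noteq> {} \<and> bounded K \<and> L \<noteq> {} \<and> bounded L
      then max (SUP x\<in>K. infdist x L) (SUP y\<in>L. infdist y K) else 0)"

definition bodies0 :: "'a::euclidean_space set set" where
  "bodies0 = {K. compact K \<and> convex K \<and> 0 \<in> interior K}"

definition bodies0_top :: "'a::euclidean_space set topology" where
  "bodies0_top = Metric_space.mtopology bodies0 hausdorff_dist"

lemma infdist_bdd_above:
  fixes K L :: "'a::metric_space set"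
  assumes "bounded K"
  shows "bdd_above ((\<lambda>x. infdist x L) ` K)"
proof -
  obtain a e where e: "\<And>y. y \<in> K \<Longrightarrow> dist a y \<le> e"
    using assms unfolding bounded_def by blast
  have "infdist y L \<le> infdist a L + e" if "y \<in> K" for y
    using infdist_triangle[of y L a] e[OF that] by (simp add: dist_commute)
  then show ?thesis by (auto intro!: bdd_aboveI)
qed

lemma infdist_le_SUP:
  fixes K L :: "'a::metric_space set"
  assumes "bounded K" "x \<in> K"
  shows "infdist x L \<le> (SUP x\<in>K. infdist x L)"
  by (rule cSUP_upper[OF assms(2) infdist_bdd_above[OF assms(1)]])

lemma SUP_infdist_triangle:
  fixes A B C :: "'a::metric_space set"
  assumes A: "A \<noteq> {}" "bounded A" and B: "B \<noteq> {}" "bounded B"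
  shows "(SUP x\<in>A. infdist x C) \<le> (SUP x\<in>A. infdist x B) + (SUP y\<in>B. infdist y C)"
proof (rule cSUP_least[OF A(1)])
  fix x assume x: "x \<in> A"
  have "infdist x C - (SUP y\<in>B. infdist y C) \<le> dist x b" if "b \<in> B" for b
    using infdist_triangle[of x C b] infdist_le_SUP[OF B(2) that, of C] by simp
  then have "infdist x C - (SUP y\<in>B. infdist y C) \<le> infdist x B"
    unfolding infdist_notempty[OF B(1), of x] by (intro cINF_greatest[OF B(1)])
  then show "infdist x C \<le> (SUP x\<in>A. infdist x B) + (SUP y\<in>B. infdist y C)"
    using infdist_le_SUP[OF A(2) x, of B] by simp
qed

lemma hausdorff_dist_nonneg: "0 \<le> hausdorff_dist K L"
proof (cases "K \<noteq> {} \<and> bounded K")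
  case True
  then obtain x where "x \<in> K" by blast
  then have "0 \<le> (SUP x\<in>K. infdist x L)"
    using infdist_le_SUP[of K x L] True infdist_nonneg[of x L] by linarith
  then show ?thesis by (simp add: hausdorff_dist_def le_max_iff_disj)
qed (auto simp: hausdorff_dist_def)

lemma bodies0_props:
  assumes "K \<in> bodies0"
  shows "K \<noteq> {}" "bounded K" "closed K"
  using assms interior_subset
  by (auto simp: bodies0_def compact_imp_bounded compact_imp_closed)

lemma Metric_space_bodies0:
  "Metric_space (bodies0 :: 'a::euclidean_space set set) hausdorff_dist"
proof
  fix A B C :: "'a set"
  show "0 \<le> hausdorff_dist A B" by (rule hausdorff_dist_nonneg)
  show "hausdorff_dist A B = hausdorff_dist B A"
    by (auto simp: hausdorff_dist_def max.commute)
  have sub: "K \<subseteq> L" if "K \<in> bodies0" "L \<in> bodies0" "hausdorff_dist K L = 0" for K L :: "'a set"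
  proof
    fix x assume x: "x \<in> K"
    have "infdist x L \<le> hausdorff_dist K L"
      using infdist_le_SUP[OF bodies0_props(2)[OF that(1)] x, of L]
        bodies0_props[OF that(1)] bodies0_props[OF that(2)]
      by (simp add: hausdorff_dist_def le_max_iff_disj)
    then have "infdist x L = 0" using that(3) infdist_nonneg[of x L] by linarith
    then show "x \<in> L"
      using in_closed_iff_infdist_zero bodies0_props[OF that(2)] by blast
  qed
  have comm: "hausdorff_dist A B = hausdorff_dist B A"
    by (auto simp: hausdorff_dist_def max.commute)
  show "hausdorff_dist A B = 0 \<longleftrightarrow> A = B" if "A \<in> bodies0" "B \<in> bodies0"
  proof
    assume "hausdorff_dist A B = 0"
    then show "A = B" using sub[OF that] sub[OF that(2,1)] comm by auto
  next
    assume "A = B"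
    then show "hausdorff_dist A B = 0"
      using bodies0_props[OF that(1)] by (simp add: hausdorff_dist_def)
  qed
  show "hausdorff_dist A C \<le> hausdorff_dist A B + hausdorff_dist B C"
    if "A \<in> bodies0" "B \<in> bodies0" "C \<in> bodies0"
    using SUP_infdist_triangle[of A B C] SUP_infdist_triangle[of C B A]
      bodies0_props[OF that(1)] bodies0_props[OF that(2)] bodies0_props[OF that(3)]
    unfolding hausdorff_dist_def by simp linarith
qed

lemma topspace_bodies0_top [simp]: "topspace bodies0_top = bodies0"
  unfolding bodies0_top_def
  by (rule Metric_space.topspace_mtopology[OF Metric_space_bodies0])

definition involution_on :: "'a topology \<Rightarrow> ('a \<Rightarrow> 'a) \<Rightarrow> bool" where
  "involution_on X \<alpha> \<longleftrightarrow> continuous_map X X \<alpha> \<and> (\<forall>x\<in>topspace X. \<alpha> (\<alpha> x) = x)"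

definition equivariant_on :: "'a set \<Rightarrow> ('a \<Rightarrow> 'a) \<Rightarrow> ('b \<Rightarrow> 'b) \<Rightarrow> ('a \<Rightarrow> 'b) \<Rightarrow> bool" where
  "equivariant_on S \<alpha> \<beta> f \<longleftrightarrow> (\<forall>x\<in>S. f (\<alpha> x) = \<beta> (f x))"

definition mean_on :: "'a topology \<Rightarrow> ('a \<Rightarrow> 'a \<Rightarrow> 'a) \<Rightarrow> bool" where
  "mean_on X p \<longleftrightarrow>
     continuous_map (prod_topology X X) X (\<lambda>(x, y). p x y) \<and>
     (\<forall>x\<in>topspace X. p x x = x) \<and>
     (\<forall>x\<in>topspace X. \<forall>y\<in>topspace X. p x y = p y x)"

definition equivariant_mean_on :: "'a topology \<Rightarrow> ('a \<Rightarrow> 'a) \<Rightarrow> ('a \<Rightarrow> 'a \<Rightarrow> 'a) \<Rightarrow> bool" where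
  "equivariant_mean_on X \<alpha> p \<longleftrightarrow>
     mean_on X p \<and>
     (\<forall>x\<in>topspace X. \<forall>y\<in>topspace X. p (\<alpha> x) (\<alpha> y) = \<alpha> (p x y))"

(* A Z_2-space containing (Y, \<alpha>) as a closed invariant subset is a Z_2-space (Z, \<beta>) with a
   closed invariant subset A and an equivariant homeomorphism e from (Y, \<alpha>) onto (A, \<beta>); this
   lets the points of Z have any type 'z. The type argument is the type over which the
   ambient spaces range: a statement about all metrizable Z_2-spaces leaves 'z free. *)
definition Z2_AR :: "'z itself \<Rightarrow> 'a topology \<Rightarrow> ('a \<Rightarrow> 'a) \<Rightarrow> bool" where
  "Z2_AR _ Y \<alpha> \<longleftrightarrow>
     metrizable_space Y \<and> involution_on Y \<alpha> \<and>
     (\<forall>(Z :: 'z topology) \<beta> A e.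
        metrizable_space Z \<and> involution_on Z \<beta> \<and>
        closedin Z A \<and> \<beta> ` A = A \<and>
        homeomorphic_map Y (subtopology Z A) e \<and> equivariant_on (topspace Y) \<alpha> \<beta> e
        \<longrightarrow> (\<exists>r. continuous_map Z (subtopology Z A) r \<and> (\<forall>x\<in>A. r x = x) \<and>
                 equivariant_on (topspace Z) \<beta> \<beta> r))"

end

theory Submission
  imports Defs
begin

text \<open>
  The family of convex bodies around the origin is a lattice under inclusion, with intersection as
  meet and convex hull of the union as join (written \<open>\<or>\<close> here). The proof rests on
  the fact that the order-reversing involution \<open>\<alpha>\<close> interchanges meet and join.

  \<^emph>\<open>The mean.\<close> Given \<open>M \<subseteq> J\<close>, both the Minkowski midpoint \<open>A = (M + J) / 2\<close> and its
  conjugate \<open>A* = \<alpha> ((\<alpha> M + \<alpha> J) / 2)\<close> lie between \<open>M\<close> and \<open>J\<close>, and \<open>\<alpha>\<close> exchanges the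
  two roles. Replacing \<open>(M, J)\<close> by \<open>(A \<inter> A*, A \<or> A*)\<close> shrinks the order interval and
  commutes with \<open>(M, J) \<mapsto> (\<alpha> J, \<alpha> M)\<close>. Started from \<open>(K \<inter> L, K \<or> L)\<close> and iterated, the two
  sequences are monotone and bounded, so each converges, and by continuity the pair of limits is a
  fixed point of the step. Minkowski cancellation shows that a fixed pair has \<open>M = J\<close>
  (lemma \<open>midpoint_squeeze_fixed\<close>). The common limit is the mean of \<open>K\<close> and \<open>L\<close>. It is equivariant
  because the whole construction is self-dual, and it is continuous because it is squeezed between
  continuous functions that come arbitrarily close to it (lemma \<open>limitin_dual_mean\<close>).

  \<^emph>\<open>The retraction.\<close> A mean turns an extension \<open>g\<close> of an equivariant map into an equivariant
  extension, namely \<open>z \<mapsto> p (g z) (\<alpha> (g (\<beta> z)))\<close>. So it remains to extend continuous maps \<open>f\<close> from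
  a closed subset \<open>A\<close> of a metrizable space, without regard to symmetry. After dividing \<open>f a\<close> by
  its inradius, whose extension is supplied by Tietze's theorem, this is done by a multiplicative
  version of Hausdorff's formula for extending real functions: the intersection over \<open>a \<in> A\<close> of
  the dilates of \<open>f a\<close> by \<open>d(z, a) / d(z, A)\<close> (theorem \<open>continuous_bodies0_extension\<close>).

  All limits are computed multiplicatively: \<open>K\<close> and \<open>L\<close> are close if each is contained in a
  dilate of the other by a factor near 1 (lemma \<open>limitin_bodies0\<close>). This notion of closeness is preserved
  by every monotone homogeneous operation.
\<close>

section \<open>Cancellation for Minkowski sums\<close>

text \<open>
  Radstroem's cancellation law \<open>K + L \<subseteq> K + L' \<Longrightarrow> L \<subseteq> L'\<close>: minima of a linear functional
  add up under Minkowski sums, so a functional separating a point of \<open>L\<close> from \<open>L'\<close> would give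
  the left-hand side a smaller minimum than the right-hand side.
\<close>

lemma Minkowski_cancel:
  fixes K L L' :: "'a::euclidean_space set"
  assumes K: "compact K" "K \<noteq> {}" and L': "closed L'" "convex L'"
    and sums: "\<And>k l. k \<in> K \<Longrightarrow> l \<in> L \<Longrightarrow> \<exists>k'\<in>K. \<exists>l'\<in>L'. k + l = k' + l'"
  shows "L \<subseteq> L'"
proof (rule ccontr)
  assume "\<not> L \<subseteq> L'"
  then obtain x where x: "x \<in> L" "x \<notin> L'" by blast
  obtain u b where ub: "u \<bullet> x < b" "\<And>y. y \<in> L' \<Longrightarrow> b < u \<bullet> y"
    using separating_hyperplane_closed_point[OF L'(2,1) x(2)] by blast
  obtain k where k: "k \<in> K" "\<And>y. y \<in> K \<Longrightarrow> u \<bullet> k \<le> u \<bullet> y"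
    using continuous_attains_inf[OF K continuous_on_inner[OF continuous_on_const continuous_on_id]]
    by blast
  obtain k' l' where "k' \<in> K" "l' \<in> L'" "k + x = k' + l'"
    using sums[OF k(1) x(1)] by blast
  then have "u \<bullet> k + u \<bullet> x = u \<bullet> k' + u \<bullet> l'" "u \<bullet> k \<le> u \<bullet> k'" "b < u \<bullet> l'"
    using k(2) ub(2) by (auto simp flip: inner_add_right)
  with ub(1) show False by linarith
qed

section \<open>Dilations of convex bodies\<close>

abbreviation dilate :: "real \<Rightarrow> 'a::real_vector set \<Rightarrow> 'a set" where
  "dilate c K \<equiv> (*\<^sub>R) c ` K"

lemma mem_dilate_iff: "c > 0 \<Longrightarrow> x \<in> dilate c K \<longleftrightarrow> (1 / c) *\<^sub>R x \<in> K"
  by (force simp: image_iff)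

lemma dilate_dilate: "dilate a (dilate b K) = dilate (a * b) K"
  by (auto simp: image_image)

lemma bodies0D:
  assumes "K \<in> bodies0"
  shows "compact K" "convex K" "0 \<in> interior K" "0 \<in> K" "closed K" "bounded K" "K \<noteq> {}"
  using assms interior_subset bodies0_props[OF assms] by (auto simp: bodies0_def)

lemma bodies0_superset:
  assumes "M \<in> bodies0" "M \<subseteq> K" "compact K" "convex K"
  shows "K \<in> bodies0"
  using assms interior_mono[of M K] by (auto simp: bodies0_def)

lemma dilate_bodies0:
  assumes "K \<in> bodies0" "c > 0"
  shows "dilate c K \<in> bodies0"
proof -
  have "open (dilate c (interior K))" using assms(2) by (intro open_scaling) auto
  moreover have "dilate c (interior K) \<subseteq> dilate c K" using interior_subset by blast
  moreover have "0 \<in> dilate c (interior K)"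
    using bodies0D[OF assms(1)] by (metis image_eqI scaleR_zero_right)
  ultimately have "0 \<in> interior (dilate c K)" using interior_maximal by blast
  then show ?thesis
    using bodies0D[OF assms(1)] by (auto simp: bodies0_def intro: compact_scaling convex_scaling)
qed

lemma dilate_mono_factor:
  assumes "K \<in> bodies0" "0 < a" "a \<le> b"
  shows "dilate a K \<subseteq> dilate b K"
proof
  fix x assume "x \<in> dilate a K"
  then have "(1/a) *\<^sub>R x \<in> K" using assms by (simp add: mem_dilate_iff)
  then have "(a/b) *\<^sub>R ((1/a) *\<^sub>R x) + (1 - a/b) *\<^sub>R 0 \<in> K"
    using assms bodies0D[OF assms(1)] by (intro convexD) (auto simp: field_simps)
  then show "x \<in> dilate b K" using assms by (simp add: mem_dilate_iff)
qed

lemma dilate_ge_self: "K \<in> bodies0 \<Longrightarrow> 1 \<le> c \<Longrightarrow> K \<subseteq> dilate c K"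
  using dilate_mono_factor[of K 1 c] by simp

text \<open>
  This open room around a body is what lets compactness turn a decreasing intersection into a limit
  in \<open>limitin_bodies0_decreasing\<close>.
\<close>

lemma subset_interior_dilate:
  fixes K :: "'a::euclidean_space set"
  assumes K: "K \<in> bodies0" and c: "c > 1"
  shows "K \<subseteq> interior (dilate c K)"
proof
  fix x assume x: "x \<in> K"
  have "x - (1 - 1/c) *\<^sub>R (x - 0) \<in> interior K"
    using x c bodies0D[OF K] closure_subset
    by (intro mem_interior_closure_convex_shrink) (auto simp: field_simps)
  then have "(1/c) *\<^sub>R x \<in> interior K" by (simp add: algebra_simps)
  then have "x \<in> dilate c (interior K)" using c by (simp add: mem_dilate_iff)
  moreover have "open (dilate c (interior K))" using c by (intro open_scaling) auto
  moreover have "dilate c (interior K) \<subseteq> dilate c K" using interior_subset by blast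
  ultimately show "x \<in> interior (dilate c K)" using interior_maximal by blast
qed

section \<open>The Hausdorff topology in multiplicative terms\<close>

definition ratio_close :: "real \<Rightarrow> 'a::real_vector set \<Rightarrow> 'a set \<Rightarrow> bool" where
  "ratio_close c K L \<longleftrightarrow> K \<subseteq> dilate c L \<and> L \<subseteq> dilate c K"

lemma ratio_close_refl: "K \<in> bodies0 \<Longrightarrow> 1 \<le> c \<Longrightarrow> ratio_close c K K"
  by (simp add: ratio_close_def dilate_ge_self)

lemma ratio_close_mono:
  "ratio_close a K L \<Longrightarrow> K \<in> bodies0 \<Longrightarrow> L \<in> bodies0 \<Longrightarrow> 0 < a \<Longrightarrow> a \<le> b \<Longrightarrow> ratio_close b K L"
  unfolding ratio_close_def using dilate_mono_factor by blast

lemma dilate_trans: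
  "K \<subseteq> dilate a L \<Longrightarrow> L \<subseteq> dilate b N \<Longrightarrow> K \<subseteq> dilate (a * b) N"
  using image_mono[of L "dilate b N" "(*\<^sub>R) a"] by (auto simp: dilate_dilate)

text \<open>
  Each point \<open>x\<close> of one body is moved into the other by shrinking it to \<open>x / c\<close>, a displacement
  controlled by the circumradius.
\<close>

lemma hausdorff_dist_le_of_ratio_close:
  assumes K: "K \<in> bodies0" and L: "L \<in> bodies0" and R: "K \<subseteq> cball 0 R" "L \<subseteq> cball 0 R"
    and c: "c \<ge> 1" and rc: "ratio_close c K L"
  shows "hausdorff_dist K L \<le> (c - 1) * R"
proof -
  have *: "infdist x N \<le> (c - 1) * R"
    if "x \<in> M" "M \<subseteq> dilate c N" "M \<subseteq> cball 0 R" for x and M N :: "'a set"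
  proof -
    have y: "(1/c) *\<^sub>R x \<in> N" using that c mem_dilate_iff[of c x N] by auto
    have "dist x ((1/c) *\<^sub>R x) = norm ((1 - 1/c) *\<^sub>R x)"
      by (simp add: dist_norm algebra_simps)
    also have "\<dots> = (1 - 1/c) * norm x" using c by (simp only: norm_scaleR) (auto simp: field_simps)
    also have "\<dots> \<le> (c - 1) * R"
    proof (rule mult_mono)
      have "(1 - 1/c) = (c - 1) / c" using c by (simp add: field_simps)
      also have "\<dots> \<le> (c - 1) / 1" using c by (intro divide_left_mono) auto
      finally show "1 - 1/c \<le> c - 1" by simp
    qed (use that c in auto)
    finally show ?thesis using infdist_le[OF y, of x] by linarith
  qed
  have "(SUP x\<in>K. infdist x L) \<le> (c - 1) * R" "(SUP x\<in>L. infdist x K) \<le> (c - 1) * R"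
    using bodies0D[OF K] bodies0D[OF L] rc R
    by (auto intro!: cSUP_least * simp: ratio_close_def)
  then show ?thesis using bodies0D[OF K] bodies0D[OF L] by (simp add: hausdorff_dist_def)
qed

lemma near_point_of_hausdorff_dist:
  assumes K: "K \<in> bodies0" and L: "L \<in> bodies0" and d: "hausdorff_dist K L < r"
  shows "x \<in> K \<Longrightarrow> \<exists>y\<in>L. dist x y < r" "x \<in> L \<Longrightarrow> \<exists>y\<in>K. dist x y < r"
proof -
  have *: "\<exists>y\<in>N. dist x y < r"
    if "x \<in> M" "M \<in> bodies0" "N \<in> bodies0" "hausdorff_dist M N < r" for x and M N :: "'a set"
  proof -
    note M = bodies0D[OF that(2)] and N = bodies0D[OF that(3)]
    have "infdist x N \<le> hausdorff_dist M N"
      using infdist_le_SUP[OF M(6) that(1), of N] M N by (simp add: hausdorff_dist_def)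
    then have "infdist x N < r" using that by simp
    then show ?thesis
      using infdist_attains_inf[OF N(5,7), of x] by metis
  qed
  have "hausdorff_dist L K < r"
    using d Metric_space.commute[OF Metric_space_bodies0] by metis
  then show "x \<in> K \<Longrightarrow> \<exists>y\<in>L. dist x y < r" "x \<in> L \<Longrightarrow> \<exists>y\<in>K. dist x y < r"
    using * K L d by blast+
qed

text \<open>
  Here the interior point matters. If \<open>K\<close> contains the ball of radius \<open>\<rho>\<close> then a displacement of
  length below \<open>t \<rho>\<close> lies in \<open>t K\<close>, so Hausdorff closeness gives \<open>L \<subseteq> K + t K = (1 + t) K\<close> and
  \<open>(1 - t) K + t K = K \<subseteq> L + t K\<close>. Cancelling \<open>t K\<close> in the latter yields \<open>(1 - t) K \<subseteq> L\<close>.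
\<close>

lemma ratio_close_of_hausdorff_dist:
  assumes K: "K \<in> bodies0" and c: "c > 1"
  obtains r where "r > 0"
    "\<And>L. L \<in> bodies0 \<Longrightarrow> hausdorff_dist K L < r \<Longrightarrow> ratio_close c K L"
proof -
  obtain \<rho> where \<rho>: "\<rho> > 0" "cball 0 \<rho> \<subseteq> K"
    using bodies0D(3)[OF K] mem_interior_cball by blast
  \<comment> \<open>The choice makes \<open>1 - t = 1 / c\<close>, and then \<open>1 + t \<le> c\<close> holds too.\<close>
  define t where "t = 1 - 1/c"
  have t: "0 < t" "t < 1" "1 + t \<le> c" "1 - t = 1 / c"
  proof -
    have "(c - 1)\<^sup>2 \<ge> 0" by simp
    then show "1 + t \<le> c" using c by (simp add: t_def field_simps power2_eq_square)
  qed (use c in \<open>auto simp: t_def field_simps\<close>)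
  have small: "\<exists>k'\<in>K. v = t *\<^sub>R k'" if "norm v < t * \<rho>" for v :: 'a
  proof
    show "v = t *\<^sub>R ((1/t) *\<^sub>R v)" using t by simp
    have "(1/t) *\<^sub>R v \<in> cball 0 \<rho>" using that t by (simp add: field_simps)
    then show "(1/t) *\<^sub>R v \<in> K" using \<rho> by blast
  qed
  show ?thesis
  proof
    show "t * \<rho> > 0" using t \<rho> by simp
    fix L assume L: "L \<in> bodies0" and d: "hausdorff_dist K L < t * \<rho>"
    have "L \<subseteq> dilate (1 + t) K"
    proof
      fix y assume "y \<in> L"
      then obtain k where k: "k \<in> K" "dist y k < t * \<rho>"
        using near_point_of_hausdorff_dist(2)[OF K L d] by blast
      obtain k' where k': "k' \<in> K" "y - k = t *\<^sub>R k'"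
        using small[of "y - k"] k by (auto simp: dist_norm)
      have "(1/(1+t)) *\<^sub>R k + (t/(1+t)) *\<^sub>R k' \<in> K"
        using k k' t bodies0D(2)[OF K] by (intro convexD) (auto simp: field_simps)
      moreover have "(1/(1+t)) *\<^sub>R y = (1/(1+t)) *\<^sub>R k + (t/(1+t)) *\<^sub>R k'"
      proof -
        have "y = k + t *\<^sub>R k'" using k'(2) by (simp add: algebra_simps)
        then show ?thesis by (simp add: scaleR_add_right)
      qed
      ultimately show "y \<in> dilate (1+t) K" using t by (simp add: mem_dilate_iff)
    qed
    also have "\<dots> \<subseteq> dilate c K" using dilate_mono_factor[OF K, of "1+t" c] t by simp
    finally have 1: "L \<subseteq> dilate c K" .
    have "dilate (1 - t) K \<subseteq> L"
    proof (rule Minkowski_cancel)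
      show "compact (dilate t K)" using bodies0D[OF K] by (intro compact_scaling)
      show "dilate t K \<noteq> {}" "closed L" "convex L" using bodies0D[OF K] bodies0D[OF L] by auto
      fix k l assume "k \<in> dilate t K" "l \<in> dilate (1 - t) K"
      then obtain a b where ab: "a \<in> K" "b \<in> K" "k = t *\<^sub>R a" "l = (1 - t) *\<^sub>R b" by auto
      have "k + l \<in> K" unfolding ab(3,4)
        using ab t bodies0D(2)[OF K] by (intro convexD) auto
      then obtain y where y: "y \<in> L" "dist (k + l) y < t * \<rho>"
        using near_point_of_hausdorff_dist(1)[OF K L d] by blast
      obtain k' where "k' \<in> K" "k + l - y = t *\<^sub>R k'"
        using small[of "k + l - y"] y by (auto simp: dist_norm)
      then show "\<exists>k'\<in>dilate t K. \<exists>l'\<in>L. k + l = k' + l'"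
        using y(1) by (metis diff_add_cancel image_eqI)
    qed
    then have "K \<subseteq> dilate c L"
      using c t by (force simp: mem_dilate_iff)
    with 1 show "ratio_close c K L" by (simp add: ratio_close_def)
  qed
qed

lemma limitin_bodies0:
  fixes f :: "'b \<Rightarrow> 'a::euclidean_space set"
  shows "limitin bodies0_top f K F \<longleftrightarrow>
     K \<in> bodies0 \<and> (\<forall>c>1. \<forall>\<^sub>F x in F. f x \<in> bodies0 \<and> ratio_close c K (f x))"
  (is "_ \<longleftrightarrow> _ \<and> ?R")
proof -
  interpret H: Metric_space "bodies0 :: 'a set set" hausdorff_dist
    by (rule Metric_space_bodies0)
  let ?L = "\<forall>\<epsilon>>0. \<forall>\<^sub>F x in F. f x \<in> bodies0 \<and> hausdorff_dist (f x) K < \<epsilon>"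
  have "?L \<longleftrightarrow> ?R" if K: "K \<in> bodies0"
  proof (intro iffI allI impI)
    fix c :: real assume L: ?L and c: "c > 1"
    obtain r where r: "r > 0"
        "\<And>L. L \<in> bodies0 \<Longrightarrow> hausdorff_dist K L < r \<Longrightarrow> ratio_close c K L"
      using ratio_close_of_hausdorff_dist[OF K c] by blast
    show "\<forall>\<^sub>F x in F. f x \<in> bodies0 \<and> ratio_close c K (f x)"
      using L[rule_format, OF r(1)]
      by eventually_elim (use r(2) H.commute in metis)
  next
    fix \<epsilon> :: real assume R: ?R and \<epsilon>: "\<epsilon> > 0"
    obtain R where R0: "R > 0" "K \<subseteq> cball 0 R"
      using bodies0D(6)[OF K] by (auto simp: bounded_pos subset_iff)
    define c where "c = min 2 (1 + \<epsilon> / (4 * R))"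
    have c: "c > 1" "c \<le> 2" "(c - 1) * (2 * R) < \<epsilon>"
    proof -
      have "(c - 1) * (2 * R) \<le> \<epsilon> / (4 * R) * (2 * R)"
        using R0 by (intro mult_right_mono) (auto simp: c_def)
      also have "\<dots> < \<epsilon>" using R0 \<epsilon> by (simp add: field_simps)
      finally show "(c - 1) * (2 * R) < \<epsilon>" .
    qed (use R0 \<epsilon> in \<open>auto simp: c_def\<close>)
    show "\<forall>\<^sub>F x in F. f x \<in> bodies0 \<and> hausdorff_dist (f x) K < \<epsilon>"
      using R[rule_format, OF c(1)]
    proof eventually_elim
      case (elim x)
      have "f x \<subseteq> dilate 2 K"
        using elim c dilate_mono_factor[OF K, of c 2] by (auto simp: ratio_close_def)
      also have "\<dots> \<subseteq> cball 0 (2 * R)" using R0(2) by auto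
      finally have "hausdorff_dist K (f x) \<le> (c - 1) * (2 * R)"
        using elim c R0 K by (intro hausdorff_dist_le_of_ratio_close) auto
      then show ?case using elim c H.commute by fastforce
    qed
  qed
  then show ?thesis unfolding bodies0_top_def H.limitin_metric by blast
qed

lemma Hausdorff_space_bodies0: "Hausdorff_space bodies0_top"
  unfolding bodies0_top_def
  by (rule Metric_space.Hausdorff_space_mtopology[OF Metric_space_bodies0])

lemma metrizable_space_bodies0: "metrizable_space bodies0_top"
  unfolding bodies0_top_def
  by (rule Metric_space.metrizable_space_mtopology[OF Metric_space_bodies0])

text \<open>
  A monotone operation that commutes with dilations maps pairs of \<open>c\<close>-close bodies to \<open>c\<close>-close
  bodies, so it is continuous.
\<close>

lemma limitin_bodies0_binop:
  assumes closed: "\<And>K L. K \<in> bodies0 \<Longrightarrow> L \<in> bodies0 \<Longrightarrow> op K L \<in> bodies0"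
    and mono: "\<And>K L K' L'. K \<subseteq> K' \<Longrightarrow> L \<subseteq> L' \<Longrightarrow> op K L \<subseteq> op K' L'"
    and homogeneous: "\<And>c K L. c > 0 \<Longrightarrow> op (dilate c K) (dilate c L) = dilate c (op K L)"
    and lim: "limitin bodies0_top f K F" "limitin bodies0_top g L F"
  shows "limitin bodies0_top (\<lambda>x. op (f x) (g x)) (op K L) F"
  unfolding limitin_bodies0
proof (intro conjI allI impI)
  show "op K L \<in> bodies0" using lim closed by (auto simp: limitin_bodies0)
  fix c :: real assume c: "c > 1"
  have "\<forall>\<^sub>F x in F. f x \<in> bodies0 \<and> ratio_close c K (f x)"
    "\<forall>\<^sub>F x in F. g x \<in> bodies0 \<and> ratio_close c L (g x)"
    using lim c by (auto simp: limitin_bodies0)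
  then show "\<forall>\<^sub>F x in F. op (f x) (g x) \<in> bodies0 \<and> ratio_close c (op K L) (op (f x) (g x))"
  proof eventually_elim
    case (elim x)
    then show ?case
      using closed mono homogeneous[of c] c unfolding ratio_close_def
      by (metis (no_types, lifting) less_trans zero_less_one)
  qed
qed

text \<open>
  The lower bound \<open>M\<close> keeps the origin in the interior of the intersection. The intersection
  lies in the interior of its own dilate, and by compactness so does some \<open>J N\<close>.
\<close>

lemma limitin_bodies0_decreasing:
  fixes J :: "nat \<Rightarrow> 'a::euclidean_space set"
  assumes M: "M \<in> bodies0" "\<And>n. M \<subseteq> J n" and J: "\<And>n. J n \<in> bodies0"
    and dec: "\<And>n. J (Suc n) \<subseteq> J n"
  shows "limitin bodies0_top J (\<Inter>n. J n) sequentially"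
  unfolding limitin_bodies0
proof (intro conjI allI impI)
  let ?P = "\<Inter>n. J n"
  have dec': "J n \<subseteq> J m" if "m \<le> n" for m n using that dec lift_Suc_antimono_le by metis
  show P: "?P \<in> bodies0"
  proof (rule bodies0_superset[OF M(1)])
    show "compact ?P" using bodies0D[OF J] by (intro compact_Inter) auto
    show "convex ?P" using bodies0D[OF J] by (intro convex_INT) auto
  qed (use M(2) in auto)
  fix c :: real assume c: "c > 1"
  have sub: "?P \<subseteq> interior (dilate c ?P)" by (rule subset_interior_dilate[OF P c])
  obtain N where N: "J N - interior (dilate c ?P) = {}"
  proof (rule ccontr)
    assume "\<not> thesis"
    then have "\<And>n. J n - interior (dilate c ?P) \<noteq> {}" using that by blast
    then have "\<Inter>(range (\<lambda>n. J n - interior (dilate c ?P))) \<noteq> {}"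
      using dec' bodies0D(1)[OF J]
      by (intro compact_nest) (auto intro: compact_diff)
    then show False using sub by blast
  qed
  show "\<forall>\<^sub>F n in sequentially. J n \<in> bodies0 \<and> ratio_close c ?P (J n)"
    using eventually_ge_at_top[of N]
  proof eventually_elim
    case (elim n)
    have "?P \<subseteq> dilate c (J n)" using dilate_ge_self[OF J, of c n] c by auto
    moreover have "J n \<subseteq> dilate c ?P" using dec'[OF elim] N interior_subset by blast
    ultimately show ?case using J by (simp add: ratio_close_def)
  qed
qed

section \<open>Intersection, join and midpoint of convex bodies\<close>

definition join :: "'a::real_vector set \<Rightarrow> 'a set \<Rightarrow> 'a set" where
  "join K L = convex hull (K \<union> L)"

definition midpoint_body :: "'a::real_vector set \<Rightarrow> 'a set \<Rightarrow> 'a set" where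
  "midpoint_body K L = (\<lambda>(x, y). midpoint x y) ` (K \<times> L)"

lemma midpoint_bodyI: "x \<in> K \<Longrightarrow> y \<in> L \<Longrightarrow> midpoint x y \<in> midpoint_body K L"
  by (force simp: midpoint_body_def)

lemma midpoint_bodyE:
  assumes "z \<in> midpoint_body K L"
  obtains x y where "x \<in> K" "y \<in> L" "z = midpoint x y"
  using assms by (auto simp: midpoint_body_def)

lemma midpoint_body_commute: "midpoint_body K L = midpoint_body L K"
proof -
  have "midpoint_body K L \<subseteq> midpoint_body L K" for K L :: "'a set"
    using midpoint_bodyI[of _ L _ K] by (metis midpoint_bodyE midpoint_sym subsetI)
  then show ?thesis by blast
qed

lemma midpoint_body_mono: "K \<subseteq> K' \<Longrightarrow> L \<subseteq> L' \<Longrightarrow> midpoint_body K L \<subseteq> midpoint_body K' L'"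
  by (auto simp: midpoint_body_def)

lemma midpoint_body_self: "convex K \<Longrightarrow> midpoint_body K K = K"
proof
  assume K: "convex K"
  show "midpoint_body K K \<subseteq> K"
  proof
    fix z assume "z \<in> midpoint_body K K"
    then obtain x y where "x \<in> K" "y \<in> K" "z = midpoint x y" by (rule midpoint_bodyE)
    then show "z \<in> K"
      using convexD[OF K, of x y "1/2" "1/2"] by (simp add: midpoint_def scaleR_add_right)
  qed
  show "K \<subseteq> midpoint_body K K"
    using midpoint_bodyI[of _ K _ K] by (metis midpoint_idem subsetI)
qed

lemma midpoint_body_cancel:
  fixes K L L' :: "'a::euclidean_space set"
  assumes "compact K" "K \<noteq> {}" "closed L'" "convex L'"
    and sub: "midpoint_body K L \<subseteq> midpoint_body K L'"
  shows "L \<subseteq> L'"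
proof (rule Minkowski_cancel[OF assms(1-4)])
  fix k l assume "k \<in> K" "l \<in> L"
  then have "midpoint k l \<in> midpoint_body K L'" using midpoint_bodyI sub by blast
  then obtain k' l' where *: "k' \<in> K" "l' \<in> L'" "midpoint k l = midpoint k' l'"
    by (rule midpoint_bodyE)
  then have "k + l = k' + l'" by (simp add: midpoint_def)
  with * show "\<exists>k'\<in>K. \<exists>l'\<in>L'. k + l = k' + l'" by blast
qed

lemma midpoint_body_bodies0:
  assumes "K \<in> bodies0" "L \<in> bodies0"
  shows "midpoint_body K L \<in> bodies0"
proof -
  note K = bodies0D[OF assms(1)] and L = bodies0D[OF assms(2)]
  have eq: "midpoint_body K L = dilate (1/2) {x + y |x y. x \<in> K \<and> y \<in> L}"
  proof -
    have "midpoint x y = (1/2) *\<^sub>R (x + y)" for x y :: 'a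
      by (simp add: midpoint_def scaleR_add_right)
    then show ?thesis
      unfolding midpoint_body_def by (simp add: image_def set_eq_iff) blast
  qed
  have "{x + y |x y. x \<in> K \<and> y \<in> L} = (\<Union>x\<in>K. \<Union>y\<in>L. {x + y})" by auto
  then have "compact (midpoint_body K L)" "convex (midpoint_body K L)"
    using convex_sums[OF K(2) L(2)] compact_sums[OF K(1) L(1)] unfolding eq
    by (auto intro: compact_scaling convex_scaling)
  moreover have "0 \<in> interior (midpoint_body K L)"
  proof -
    have "K \<inter> L \<subseteq> midpoint_body K L"
      using midpoint_bodyI[of _ K _ L] by (metis Int_iff midpoint_idem subsetI)
    then show ?thesis using K(3) L(3) interior_mono by (metis IntI interior_Int subsetD)
  qed
  ultimately show ?thesis by (simp add: bodies0_def)
qed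

lemma Int_bodies0: "K \<in> bodies0 \<Longrightarrow> L \<in> bodies0 \<Longrightarrow> K \<inter> L \<in> bodies0"
  by (auto simp: bodies0_def compact_Int convex_Int)

lemma join_bodies0: "K \<in> bodies0 \<Longrightarrow> L \<in> bodies0 \<Longrightarrow> join K L \<in> bodies0"
  by (rule bodies0_superset[of K]) (auto simp: join_def hull_inc bodies0D(1) compact_convex_hull compact_Un)

lemma join_upper: "K \<subseteq> join K L" "L \<subseteq> join K L"
  by (auto simp: join_def hull_inc)

lemma join_least: "K \<subseteq> N \<Longrightarrow> L \<subseteq> N \<Longrightarrow> convex N \<Longrightarrow> join K L \<subseteq> N"
  by (simp add: join_def hull_minimal)

lemma join_commute: "join K L = join L K"
  by (simp add: join_def Un_commute)

lemma join_self: "convex K \<Longrightarrow> join K K = K"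
  by (simp add: join_def hull_same)

lemma limitin_midpoint_body:
  "limitin bodies0_top f K F \<Longrightarrow> limitin bodies0_top g L F \<Longrightarrow>
   limitin bodies0_top (\<lambda>x. midpoint_body (f x) (g x)) (midpoint_body K L) F"
proof (rule limitin_bodies0_binop[where op = midpoint_body, OF midpoint_body_bodies0 midpoint_body_mono])
  show "midpoint_body (dilate c K) (dilate c L) = dilate c (midpoint_body K L)"
    for c and K L :: "'a set"
  proof -
    have scale: "midpoint (c *\<^sub>R x) (c *\<^sub>R y) = c *\<^sub>R midpoint x y" for x y :: 'a
      by (simp add: midpoint_def scaleR_add_right scaleR_left_commute)
    show ?thesis
    proof (intro equalityI subsetI)
      fix z assume "z \<in> midpoint_body (dilate c K) (dilate c L)"
      then obtain x y where "x \<in> K" "y \<in> L" "z = midpoint (c *\<^sub>R x) (c *\<^sub>R y)"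
        by (auto elim: midpoint_bodyE)
      then show "z \<in> dilate c (midpoint_body K L)"
        using scale midpoint_bodyI by blast
    next
      fix z assume "z \<in> dilate c (midpoint_body K L)"
      then obtain x y where "x \<in> K" "y \<in> L" "z = c *\<^sub>R midpoint x y"
        by (auto elim: midpoint_bodyE)
      then show "z \<in> midpoint_body (dilate c K) (dilate c L)"
        by (auto simp flip: scale intro!: midpoint_bodyI)
    qed
  qed
qed

lemma limitin_Int:
  "limitin bodies0_top f K F \<Longrightarrow> limitin bodies0_top g L F \<Longrightarrow>
   limitin bodies0_top (\<lambda>x. f x \<inter> g x) (K \<inter> L) F"
proof (rule limitin_bodies0_binop[where op = "(\<inter>)", OF Int_bodies0])
  show "dilate c K \<inter> dilate c L = dilate c (K \<inter> L)" if "c > 0" for c and K L :: "'a set"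
    using that by (intro image_Int[symmetric]) (simp add: inj_on_def)
qed blast+

lemma limitin_join:
  "limitin bodies0_top f K F \<Longrightarrow> limitin bodies0_top g L F \<Longrightarrow>
   limitin bodies0_top (\<lambda>x. join (f x) (g x)) (join K L) F"
proof (rule limitin_bodies0_binop[where op = join, OF join_bodies0])
  show "join K L \<subseteq> join K' L'" if "K \<subseteq> K'" "L \<subseteq> L'" for K L K' L' :: "'a set"
    using that unfolding join_def by (intro hull_mono) auto
  show "join (dilate c K) (dilate c L) = dilate c (join K L)" for c and K L :: "'a set"
    by (simp add: join_def convex_hull_scaling flip: image_Un)
qed

text \<open>
  Two cancellations. Since \<open>M \<subseteq> C \<subseteq> J\<close>, the join of \<open>(M + J) / 2\<close> and \<open>C\<close> is contained in
  \<open>(C + J) / 2\<close>; if it is all of \<open>J = (J + J) / 2\<close>, then cancelling gives \<open>J \<subseteq> C\<close>. With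
  \<open>C = J\<close> the other equation becomes \<open>(M + J) / 2 = M = (M + M) / 2\<close>, and cancelling again
  gives \<open>J \<subseteq> M\<close>.
\<close>

lemma midpoint_squeeze_fixed:
  fixes M J C :: "'a::euclidean_space set"
  assumes M: "M \<in> bodies0" and J: "J \<in> bodies0" and C: "C \<in> bodies0"
    and MC: "M \<subseteq> C" and CJ: "C \<subseteq> J"
    and lower: "midpoint_body M J \<inter> C = M" and upper: "join (midpoint_body M J) C = J"
  shows "M = J"
proof -
  note MD = bodies0D[OF M] and JD = bodies0D[OF J] and CD = bodies0D[OF C]
  have "join (midpoint_body M J) C \<subseteq> midpoint_body C J"
  proof (rule join_least)
    show "midpoint_body M J \<subseteq> midpoint_body C J" using MC by (intro midpoint_body_mono) auto
    show "C \<subseteq> midpoint_body C J"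
      using midpoint_body_mono[of C C C J] CJ midpoint_body_self[OF CD(2)] by simp
    show "convex (midpoint_body C J)" using bodies0D(2)[OF midpoint_body_bodies0[OF C J]] .
  qed
  then have "J \<subseteq> midpoint_body J C"
    unfolding upper midpoint_body_commute[of C J] .
  then have "midpoint_body J J \<subseteq> midpoint_body J C"
    unfolding midpoint_body_self[OF JD(2)] .
  then have "J \<subseteq> C" by (rule midpoint_body_cancel[OF JD(1,7) CD(5,2)])
  then have "M = midpoint_body M J"
    using lower midpoint_body_mono[of M J J J] MC CJ midpoint_body_self[OF JD(2)] by blast
  then have "midpoint_body M J \<subseteq> midpoint_body M M"
    unfolding midpoint_body_self[OF MD(2)] by simp
  then have "J \<subseteq> M" by (rule midpoint_body_cancel[OF MD(1,7) MD(5,2)])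
  then show ?thesis using MC CJ by blast
qed

section \<open>The self-dual mean\<close>

locale order_reversing_involution =
  fixes \<alpha> :: "'a::euclidean_space set \<Rightarrow> 'a set"
  assumes involution: "involution_on bodies0_top \<alpha>"
    and antimono: "antimono_on bodies0 \<alpha>"
begin

lemma alpha_bodies0: "K \<in> bodies0 \<Longrightarrow> \<alpha> K \<in> bodies0"
  using involution continuous_map_image_subset_topspace unfolding involution_on_def by fastforce

lemma alpha_alpha: "K \<in> bodies0 \<Longrightarrow> \<alpha> (\<alpha> K) = K"
  using involution by (simp add: involution_on_def)

lemma alpha_antimono: "K \<in> bodies0 \<Longrightarrow> L \<in> bodies0 \<Longrightarrow> K \<subseteq> L \<Longrightarrow> \<alpha> L \<subseteq> \<alpha> K"
  using antimono by (auto simp: monotone_on_def)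

lemma limitin_alpha:
  "limitin bodies0_top f K F \<Longrightarrow> limitin bodies0_top (\<lambda>x. \<alpha> (f x)) (\<alpha> K) F"
  using involution continuous_map_limit[of bodies0_top bodies0_top \<alpha> f K F]
  by (simp add: involution_on_def o_def)

text \<open>
  An order-reversing bijection of a lattice interchanges meets and joins.
\<close>

lemma alpha_Int:
  assumes K: "K \<in> bodies0" and L: "L \<in> bodies0"
  shows "\<alpha> (K \<inter> L) = join (\<alpha> K) (\<alpha> L)"
proof
  note b = Int_bodies0[OF K L] alpha_bodies0[OF K] alpha_bodies0[OF L]
  note j = join_bodies0[OF b(2,3)]
  have "\<alpha> (join (\<alpha> K) (\<alpha> L)) \<subseteq> \<alpha> (\<alpha> K)" "\<alpha> (join (\<alpha> K) (\<alpha> L)) \<subseteq> \<alpha> (\<alpha> L)"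
    by (intro alpha_antimono b j join_upper)+
  then have "\<alpha> (join (\<alpha> K) (\<alpha> L)) \<subseteq> K \<inter> L" using alpha_alpha K L by simp
  then show "\<alpha> (K \<inter> L) \<subseteq> join (\<alpha> K) (\<alpha> L)"
    using alpha_antimono[of "\<alpha> (join (\<alpha> K) (\<alpha> L))" "K \<inter> L"] alpha_alpha[OF j] alpha_bodies0[OF j] b
    by simp
  show "join (\<alpha> K) (\<alpha> L) \<subseteq> \<alpha> (K \<inter> L)"
    using K L b by (intro join_least alpha_antimono bodies0D(2) alpha_bodies0) auto
qed

lemma alpha_join:
  assumes K: "K \<in> bodies0" and L: "L \<in> bodies0"
  shows "\<alpha> (join K L) = \<alpha> K \<inter> \<alpha> L"
  using alpha_Int[OF alpha_bodies0[OF K] alpha_bodies0[OF L]] alpha_alpha K L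
    Int_bodies0 alpha_bodies0 by metis

definition dual_midpoint :: "'a set \<Rightarrow> 'a set \<Rightarrow> 'a set" where
  "dual_midpoint K L = \<alpha> (midpoint_body (\<alpha> K) (\<alpha> L))"

text \<open>
  The shrinking order intervals whose end points converge to the mean.
\<close>

fun squeeze :: "nat \<Rightarrow> 'a set \<Rightarrow> 'a set \<Rightarrow> 'a set \<times> 'a set" where
  "squeeze 0 K L = (K \<inter> L, join K L)"
| "squeeze (Suc n) K L =
    (let (M, J) = squeeze n K L
     in (midpoint_body M J \<inter> dual_midpoint M J, join (midpoint_body M J) (dual_midpoint M J)))"

abbreviation "lower n K L \<equiv> fst (squeeze n K L)"
abbreviation "upper n K L \<equiv> snd (squeeze n K L)"

lemma squeeze_Suc:
  "lower (Suc n) K L =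
     midpoint_body (lower n K L) (upper n K L) \<inter> dual_midpoint (lower n K L) (upper n K L)"
  "upper (Suc n) K L =
     join (midpoint_body (lower n K L) (upper n K L)) (dual_midpoint (lower n K L) (upper n K L))"
  by (simp_all add: case_prod_beta)

declare squeeze.simps(2) [simp del]

lemma dual_midpoint_bodies0: "K \<in> bodies0 \<Longrightarrow> L \<in> bodies0 \<Longrightarrow> dual_midpoint K L \<in> bodies0"
  by (simp add: dual_midpoint_def alpha_bodies0 midpoint_body_bodies0)

lemma dual_midpoint_self: "K \<in> bodies0 \<Longrightarrow> dual_midpoint K K = K"
  by (simp add: dual_midpoint_def midpoint_body_self alpha_bodies0 bodies0D(2) alpha_alpha)

lemma midpoint_body_between:
  assumes "M \<in> bodies0" "J \<in> bodies0" "M \<subseteq> J"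
  shows "M \<subseteq> midpoint_body M J" "midpoint_body M J \<subseteq> J"
  using midpoint_body_mono[of M M M J] midpoint_body_mono[of M J J J] assms
  by (simp_all add: midpoint_body_self bodies0D(2))

lemma dual_midpoint_between:
  assumes "M \<in> bodies0" "J \<in> bodies0" "M \<subseteq> J"
  shows "M \<subseteq> dual_midpoint M J" "dual_midpoint M J \<subseteq> J"
proof -
  note a = alpha_bodies0[OF assms(1)] alpha_bodies0[OF assms(2)]
  note s = alpha_antimono[OF assms]
  have "\<alpha> J \<subseteq> midpoint_body (\<alpha> M) (\<alpha> J)" "midpoint_body (\<alpha> M) (\<alpha> J) \<subseteq> \<alpha> M"
    using midpoint_body_between[OF a(2,1) s] midpoint_body_commute by metis+
  note ends = this
  have "\<alpha> (midpoint_body (\<alpha> M) (\<alpha> J)) \<subseteq> \<alpha> (\<alpha> J)"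
    "\<alpha> (\<alpha> M) \<subseteq> \<alpha> (midpoint_body (\<alpha> M) (\<alpha> J))"
    by (intro alpha_antimono midpoint_body_bodies0 a ends)+
  then show "M \<subseteq> dual_midpoint M J" "dual_midpoint M J \<subseteq> J"
    using assms alpha_alpha by (auto simp: dual_midpoint_def)
qed

context
  fixes K L :: "'a set"
  assumes K: "K \<in> bodies0" and L: "L \<in> bodies0"
begin

lemma squeeze_props:
  "lower n K L \<in> bodies0 \<and> upper n K L \<in> bodies0 \<and> lower n K L \<subseteq> upper n K L"
proof (induction n)
  case 0
  show ?case using K L join_upper[of K L] by (auto simp: Int_bodies0 join_bodies0)
next
  case (Suc n)
  let ?A = "midpoint_body (lower n K L) (upper n K L)"
  let ?D = "dual_midpoint (lower n K L) (upper n K L)"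
  have "?A \<in> bodies0" "?D \<in> bodies0"
    using Suc by (auto simp: midpoint_body_bodies0 dual_midpoint_bodies0)
  then show ?case
    using join_upper[of ?A ?D] unfolding squeeze_Suc by (auto simp: Int_bodies0 join_bodies0)
qed

lemma squeeze_nested:
  "lower n K L \<subseteq> lower (Suc n) K L" "upper (Suc n) K L \<subseteq> upper n K L"
proof -
  have s: "lower n K L \<in> bodies0" "upper n K L \<in> bodies0" "lower n K L \<subseteq> upper n K L"
    using squeeze_props[of n] by auto
  note b = midpoint_body_between[OF s] dual_midpoint_between[OF s]
  show "lower n K L \<subseteq> lower (Suc n) K L" using b unfolding squeeze_Suc by blast
  show "upper (Suc n) K L \<subseteq> upper n K L"
    unfolding squeeze_Suc using b bodies0D(2)[OF s(2)] by (intro join_least)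
qed

lemma squeeze_commute: "squeeze n L K = squeeze n K L"
  by (induction n) (auto simp: Int_commute join_commute squeeze.simps(2))

text \<open>
  Applying \<open>\<alpha>\<close> to both arguments reverses every order interval of the iteration; this is the
  source of the equivariance.
\<close>

lemma lower_alpha: "lower n (\<alpha> K) (\<alpha> L) = \<alpha> (upper n K L)"
  and upper_alpha: "upper n (\<alpha> K) (\<alpha> L) = \<alpha> (lower n K L)"
proof (induction n)
  case 0
  { case 1 show ?case using alpha_join[OF K L] by simp }
  { case 2 show ?case using alpha_Int[OF K L] by simp }
next
  case (Suc n)
  let ?M = "lower n K L" and ?J = "upper n K L"
  have s: "?M \<in> bodies0" "?J \<in> bodies0" using squeeze_props[of n] by auto
  have b: "midpoint_body ?M ?J \<in> bodies0" "dual_midpoint ?M ?J \<in> bodies0"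
    "midpoint_body (\<alpha> ?M) (\<alpha> ?J) \<in> bodies0"
    using s by (auto simp: midpoint_body_bodies0 dual_midpoint_bodies0 alpha_bodies0)
  have A: "midpoint_body (\<alpha> ?J) (\<alpha> ?M) = \<alpha> (dual_midpoint ?M ?J)"
    using b by (simp add: dual_midpoint_def alpha_alpha midpoint_body_commute)
  have D: "dual_midpoint (\<alpha> ?J) (\<alpha> ?M) = \<alpha> (midpoint_body ?M ?J)"
    using s by (simp add: dual_midpoint_def alpha_alpha midpoint_body_commute)
  { case 1 show ?case
      unfolding squeeze_Suc Suc A D alpha_join[OF b(1,2)] by (simp add: Int_commute) }
  { case 2 show ?case
      unfolding squeeze_Suc Suc A D alpha_Int[OF b(1,2)] by (simp add: join_commute) }
qed

end

lemma limitin_dual_midpoint: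
  "limitin bodies0_top f K F \<Longrightarrow> limitin bodies0_top g L F \<Longrightarrow>
   limitin bodies0_top (\<lambda>x. dual_midpoint (f x) (g x)) (dual_midpoint K L) F"
  unfolding dual_midpoint_def by (intro limitin_alpha limitin_midpoint_body)

lemma limitin_squeeze:
  assumes "limitin bodies0_top f K F" "limitin bodies0_top g L F"
  shows "limitin bodies0_top (\<lambda>x. lower n (f x) (g x)) (lower n K L) F"
    and "limitin bodies0_top (\<lambda>x. upper n (f x) (g x)) (upper n K L) F"
proof (induction n)
  case 0
  { case 1 show ?case using limitin_Int[OF assms] by simp }
  { case 2 show ?case using limitin_join[OF assms] by simp }
next
  case (Suc n)
  { case 1 show ?case
      unfolding squeeze_Suc by (intro limitin_Int limitin_midpoint_body limitin_dual_midpoint Suc) }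
  { case 2 show ?case
      unfolding squeeze_Suc by (intro limitin_join limitin_midpoint_body limitin_dual_midpoint Suc) }
qed

text \<open>
  The intersection of the upper end points is their limit. It is also the limit of the lower ones,
  so the asymmetry of this definition is only apparent.
\<close>

definition dual_mean :: "'a set \<Rightarrow> 'a set \<Rightarrow> 'a set" where
  "dual_mean K L = (\<Inter>n. upper n K L)"

lemma limitin_upper_dual_mean:
  assumes "K \<in> bodies0" "L \<in> bodies0"
  shows "limitin bodies0_top (\<lambda>n. upper n K L) (dual_mean K L) sequentially"
  unfolding dual_mean_def
proof (rule limitin_bodies0_decreasing)
  have "lower 0 K L \<subseteq> lower n K L" for n
    using lift_Suc_mono_le[of "\<lambda>n. lower n K L" 0 n] squeeze_nested(1)[OF assms] by simp
  then show "lower 0 K L \<subseteq> upper n K L" for n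
    using squeeze_props[OF assms, of n] by blast
qed (use squeeze_props[OF assms] squeeze_nested(2)[OF assms] in blast)+

lemma dual_mean_bodies0: "K \<in> bodies0 \<Longrightarrow> L \<in> bodies0 \<Longrightarrow> dual_mean K L \<in> bodies0"
  using limitin_upper_dual_mean limitin_topspace by fastforce

text \<open>
  The lower end points are the images under \<open>\<alpha>\<close> of the upper end points for \<open>\<alpha> K\<close> and \<open>\<alpha> L\<close>,
  so they converge to some \<open>M\<close>. By continuity of the step, the pair of limits is a fixed pair,
  and a fixed pair is degenerate.
\<close>

lemma limitin_lower_dual_mean:
  assumes K: "K \<in> bodies0" and L: "L \<in> bodies0"
  shows "limitin bodies0_top (\<lambda>n. lower n K L) (dual_mean K L) sequentially"
proof -
  let ?J = "dual_mean K L"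
  let ?N = "dual_mean (\<alpha> K) (\<alpha> L)"
  define M where "M = \<alpha> ?N"
  note a = alpha_bodies0[OF K] alpha_bodies0[OF L]
  note s = squeeze_props[OF K L]
  have J: "?J \<in> bodies0" and N: "?N \<in> bodies0" and Mb: "M \<in> bodies0"
    using K L a dual_mean_bodies0 alpha_bodies0 by (auto simp: M_def)
  have limJ: "limitin bodies0_top (\<lambda>n. upper n K L) ?J sequentially"
    using limitin_upper_dual_mean K L by blast
  have "limitin bodies0_top (\<lambda>n. \<alpha> (upper n (\<alpha> K) (\<alpha> L))) M sequentially"
    unfolding M_def by (intro limitin_alpha limitin_upper_dual_mean a)
  moreover have "\<alpha> (upper n (\<alpha> K) (\<alpha> L)) = lower n K L" for n
    using upper_alpha[OF K L] s alpha_alpha by simp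
  ultimately have limM: "limitin bodies0_top (\<lambda>n. lower n K L) M sequentially" by simp
  have "M \<subseteq> ?J"
    unfolding dual_mean_def[of K L]
  proof (rule INF_greatest)
    fix m
    have cross: "lower n K L \<subseteq> upper m K L" for n
    proof -
      have "lower n K L \<subseteq> lower (max n m) K L"
        using lift_Suc_mono_le[of "\<lambda>n. lower n K L" n "max n m"] squeeze_nested(1)[OF K L] by simp
      also have "\<dots> \<subseteq> upper (max n m) K L" using s by blast
      also have "\<dots> \<subseteq> upper m K L"
        using lift_Suc_antimono_le[of "\<lambda>n. upper n K L" m "max n m"] squeeze_nested(2)[OF K L]
        by simp
      finally show ?thesis .
    qed
    have "\<alpha> (upper m K L) \<subseteq> ?N"
      unfolding dual_mean_def upper_alpha[OF K L]
      using s cross by (intro INF_greatest alpha_antimono) auto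
    then have "M \<subseteq> \<alpha> (\<alpha> (upper m K L))"
      unfolding M_def using s N by (intro alpha_antimono alpha_bodies0) auto
    then show "M \<subseteq> upper m K L" using s alpha_alpha by simp
  qed
  note between = dual_midpoint_between[OF Mb J this]
  \<comment> \<open>A continuous step sends the limit of a sequence to the limit of the shifted sequence, which
    is the same.\<close>
  have shift: "f' = f" if "limitin bodies0_top X f sequentially"
      "limitin bodies0_top (\<lambda>n. X (Suc n)) f' sequentially" for X :: "nat \<Rightarrow> 'a set" and f f'
    using limitin_sequentially_offset[OF that(1), of 1] that(2)
      limitin_Hausdorff_unique[OF _ _ trivial_limit_sequentially Hausdorff_space_bodies0] by simp
  have "midpoint_body M ?J \<inter> dual_midpoint M ?J = M"
    by (rule shift[OF limM], unfold squeeze_Suc)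
      (intro limitin_Int limitin_midpoint_body limitin_dual_midpoint limM limJ)
  moreover have "join (midpoint_body M ?J) (dual_midpoint M ?J) = ?J"
    by (rule shift[OF limJ], unfold squeeze_Suc)
      (intro limitin_join limitin_midpoint_body limitin_dual_midpoint limM limJ)
  ultimately have "M = ?J"
    by (intro midpoint_squeeze_fixed[OF Mb J dual_midpoint_bodies0[OF Mb J] between])
  with limM show ?thesis by simp
qed

lemma dual_mean_upper: "dual_mean K L \<subseteq> upper n K L"
  by (auto simp: dual_mean_def)

lemma dual_mean_alpha:
  assumes K: "K \<in> bodies0" and L: "L \<in> bodies0"
  shows "dual_mean (\<alpha> K) (\<alpha> L) = \<alpha> (dual_mean K L)"
proof (rule limitin_Hausdorff_unique[OF _ _ trivial_limit_sequentially Hausdorff_space_bodies0])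
  show "limitin bodies0_top (\<lambda>n. upper n (\<alpha> K) (\<alpha> L)) (dual_mean (\<alpha> K) (\<alpha> L)) sequentially"
    by (intro limitin_upper_dual_mean alpha_bodies0 K L)
  show "limitin bodies0_top (\<lambda>n. upper n (\<alpha> K) (\<alpha> L)) (\<alpha> (dual_mean K L)) sequentially"
    unfolding upper_alpha[OF K L] by (intro limitin_alpha limitin_lower_dual_mean K L)
qed

lemma lower_dual_mean:
  assumes K: "K \<in> bodies0" and L: "L \<in> bodies0"
  shows "lower n K L \<subseteq> dual_mean K L"
proof -
  have "dual_mean (\<alpha> K) (\<alpha> L) \<subseteq> upper n (\<alpha> K) (\<alpha> L)" by (rule dual_mean_upper)
  then have "\<alpha> (dual_mean K L) \<subseteq> \<alpha> (lower n K L)"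
    by (simp add: dual_mean_alpha upper_alpha K L)
  then have "\<alpha> (\<alpha> (lower n K L)) \<subseteq> \<alpha> (\<alpha> (dual_mean K L))"
    using alpha_antimono[of "\<alpha> (dual_mean K L)" "\<alpha> (lower n K L)"]
      squeeze_props[OF K L, of n] dual_mean_bodies0[OF K L] by (simp add: alpha_bodies0)
  then show ?thesis
    using squeeze_props[OF K L] dual_mean_bodies0[OF K L] alpha_alpha by simp
qed

lemma dual_mean_self: "K \<in> bodies0 \<Longrightarrow> dual_mean K K = K"
proof -
  assume K: "K \<in> bodies0"
  have "squeeze n K K = (K, K)" for n
    using K by (induction n)
      (simp_all add: squeeze.simps(2) join_self midpoint_body_self dual_midpoint_self bodies0D(2))
  then show ?thesis by (simp add: dual_mean_def)
qed

text \<open>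
  Fix a stage \<open>n\<close> at which both end points for \<open>(K, L)\<close> are within a factor \<open>sqrt c\<close> of the mean.
  The end points at stage \<open>n\<close> depend continuously on the arguments, and for nearby arguments the
  mean still lies between them.
\<close>

lemma limitin_dual_mean:
  assumes f: "limitin bodies0_top f K F" and g: "limitin bodies0_top g L F"
  shows "limitin bodies0_top (\<lambda>x. dual_mean (f x) (g x)) (dual_mean K L) F"
  unfolding limitin_bodies0
proof (intro conjI allI impI)
  have K: "K \<in> bodies0" and L: "L \<in> bodies0" using f g by (auto simp: limitin_bodies0)
  show P: "dual_mean K L \<in> bodies0" using dual_mean_bodies0[OF K L] .
  fix c :: real assume "c > 1"
  define b where "b = sqrt c"
  have b: "b > 1" "b * b = c" using \<open>c > 1\<close> by (auto simp: b_def)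
  have "\<forall>\<^sub>F n in sequentially. ratio_close b (dual_mean K L) (lower n K L) \<and>
      ratio_close b (dual_mean K L) (upper n K L)"
    using limitin_lower_dual_mean[OF K L] limitin_upper_dual_mean[OF K L] b(1)
    unfolding limitin_bodies0 by (intro eventually_conj) (auto elim: eventually_mono)
  then obtain n where n: "ratio_close b (dual_mean K L) (lower n K L)"
      "ratio_close b (dual_mean K L) (upper n K L)"
    by (auto dest: eventually_happens)
  have "\<forall>\<^sub>F x in F. f x \<in> bodies0 \<and> ratio_close b K (f x)"
    "\<forall>\<^sub>F x in F. g x \<in> bodies0 \<and> ratio_close b L (g x)"
    "\<forall>\<^sub>F x in F. lower n (f x) (g x) \<in> bodies0 \<and> ratio_close b (lower n K L) (lower n (f x) (g x))"
    "\<forall>\<^sub>F x in F. upper n (f x) (g x) \<in> bodies0 \<and> ratio_close b (upper n K L) (upper n (f x) (g x))"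
    using f g limitin_squeeze[OF f g, of n] b(1) unfolding limitin_bodies0 by blast+
  then show "\<forall>\<^sub>F x in F. dual_mean (f x) (g x) \<in> bodies0 \<and>
      ratio_close c (dual_mean K L) (dual_mean (f x) (g x))"
  proof eventually_elim
    case (elim x)
    have "dual_mean K L \<subseteq> dilate (b * b) (lower n (f x) (g x))"
      using n(1) elim unfolding ratio_close_def by (intro dilate_trans) auto
    also have "\<dots> \<subseteq> dilate (b * b) (dual_mean (f x) (g x))"
      using elim by (intro image_mono lower_dual_mean) auto
    finally have 1: "dual_mean K L \<subseteq> dilate (b * b) (dual_mean (f x) (g x))" .
    have "upper n (f x) (g x) \<subseteq> dilate (b * b) (dual_mean K L)"
      using n(2) elim unfolding ratio_close_def by (intro dilate_trans) auto
    then have "dual_mean (f x) (g x) \<subseteq> dilate (b * b) (dual_mean K L)"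
      using dual_mean_upper by blast
    with 1 show ?case using elim b dual_mean_bodies0 by (simp add: ratio_close_def)
  qed
qed

lemma equivariant_mean: "equivariant_mean_on bodies0_top \<alpha> dual_mean"
  unfolding equivariant_mean_on_def mean_on_def
proof (intro conjI ballI)
  have "limitin bodies0_top (\<lambda>z. dual_mean (fst z) (snd z)) (dual_mean (fst w) (snd w))
      (atin (prod_topology bodies0_top bodies0_top) w)"
    if "w \<in> topspace (prod_topology bodies0_top bodies0_top)" for w :: "'a set \<times> 'a set"
    using that by (intro limitin_dual_mean)
      (auto intro: limitin_continuous_map[OF continuous_map_fst] limitin_continuous_map[OF continuous_map_snd])
  then show "continuous_map (prod_topology bodies0_top bodies0_top) bodies0_top (\<lambda>(x, y). dual_mean x y)"
    unfolding continuous_map_atin case_prod_beta by blast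
qed (simp_all add: dual_mean_self dual_mean_alpha, simp add: dual_mean_def squeeze_commute)

end

section \<open>Extending continuous families of convex bodies\<close>

text \<open>
  The radius of the largest ball around the origin inside \<open>K\<close>, written as the distance of the
  origin from the complement.
\<close>

definition inradius :: "'a::real_normed_vector set \<Rightarrow> real" where
  "inradius K = infdist 0 (- K)"

lemma ball_inradius: "ball 0 (inradius K) \<subseteq> K"
  using infdist_le[of _ "- K" 0] by (force simp: inradius_def)

lemma inradius_pos:
  fixes K :: "'a::euclidean_space set"
  assumes "K \<in> bodies0"
  shows "0 < inradius K"
proof -
  obtain r where r: "r > 0" "ball 0 r \<subseteq> K"
    using bodies0D(3)[OF assms] mem_interior by blast
  have "- K \<noteq> {}" using bodies0D(6)[OF assms] not_bounded_UNIV by (metis Compl_empty_eq double_complement)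
  then have "r \<le> inradius K"
    unfolding inradius_def infdist_notempty[OF \<open>- K \<noteq> {}\<close>] using r by (intro cINF_greatest) force+
  with r show ?thesis by simp
qed

lemma inradius_le_dilate:
  fixes K L :: "'a::euclidean_space set"
  assumes "L \<in> bodies0" "K \<subseteq> dilate c L" "c > 0"
  shows "inradius K \<le> c * inradius L"
proof -
  have ne: "- L \<noteq> {}"
    using bodies0D(6)[OF assms(1)] not_bounded_UNIV by (metis Compl_empty_eq double_complement)
  have "inradius K / c \<le> dist 0 x" if "x \<in> - L" for x
  proof -
    have "c *\<^sub>R x \<in> - K" using that assms(2,3) by auto
    then have "inradius K \<le> c * norm x"
      using infdist_le[of "c *\<^sub>R x" "- K" 0] assms(3) by (simp add: inradius_def)
    then show ?thesis using assms(3) by (simp add: field_simps)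
  qed
  then have "inradius K / c \<le> inradius L"
    unfolding inradius_def[of L] infdist_notempty[OF ne] by (intro cINF_greatest ne)
  then show ?thesis using assms(3) by (simp add: field_simps)
qed

lemma tendsto_inradius:
  fixes K :: "'a::euclidean_space set"
  assumes f: "limitin bodies0_top f K F"
  shows "((\<lambda>x. inradius (f x)) \<longlongrightarrow> inradius K) F"
proof (rule tendstoI)
  fix \<epsilon> :: real assume \<epsilon>: "\<epsilon> > 0"
  have K: "K \<in> bodies0" using f by (simp add: limitin_bodies0)
  let ?R = "inradius K"
  have R: "?R > 0" by (rule inradius_pos[OF K])
  define c where "c = 1 + \<epsilon> / (2 * ?R)"
  have c: "c > 1" "(c - 1) * ?R < \<epsilon>" using \<epsilon> R by (auto simp: c_def)
  have "\<forall>\<^sub>F x in F. f x \<in> bodies0 \<and> ratio_close c K (f x)"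
    using f c(1) by (simp add: limitin_bodies0)
  then show "\<forall>\<^sub>F x in F. dist (inradius (f x)) ?R < \<epsilon>"
  proof eventually_elim
    case (elim x)
    let ?r = "inradius (f x)"
    have le: "?R \<le> c * ?r" "?r \<le> c * ?R"
      using elim K c by (auto intro!: inradius_le_dilate simp: ratio_close_def)
    have "?R - ?r \<le> (c - 1) * ?R"
    proof (cases "?r \<le> ?R")
      case True
      have "?R - ?r \<le> (c - 1) * ?r" using le(1) by (simp add: algebra_simps)
      also have "\<dots> \<le> (c - 1) * ?R" using True c by (intro mult_left_mono) auto
      finally show ?thesis .
    next
      case False
      then show ?thesis using c R by (smt (verit) mult_pos_pos)
    qed
    moreover have "?r - ?R \<le> (c - 1) * ?R" using le(2) by (simp add: algebra_simps)
    ultimately show ?case using c(2) by (simp add: dist_real_def)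
  qed
qed

lemma limitin_dilate:
  fixes K :: "'a::euclidean_space set"
  assumes f: "limitin bodies0_top f K F" and r: "(r \<longlongrightarrow> r0) F" and r0: "r0 > 0"
  shows "limitin bodies0_top (\<lambda>x. dilate (r x) (f x)) (dilate r0 K) F"
  unfolding limitin_bodies0
proof (intro conjI allI impI)
  have K: "K \<in> bodies0" using f by (simp add: limitin_bodies0)
  show "dilate r0 K \<in> bodies0" by (rule dilate_bodies0[OF K r0])
  fix c :: real assume "c > 1"
  define b where "b = sqrt c"
  have b: "b > 1" "b * b = c" using \<open>c > 1\<close> by (auto simp: b_def)
  have "r0 / b < r0" "r0 < b * r0" using b r0 by (auto simp: field_simps)
  then have "\<forall>\<^sub>F x in F. r0 / b < r x" "\<forall>\<^sub>F x in F. r x < b * r0"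
    using r order_tendstoD by blast+
  moreover have "\<forall>\<^sub>F x in F. f x \<in> bodies0 \<and> ratio_close b K (f x)"
    using f b(1) by (simp add: limitin_bodies0)
  ultimately show "\<forall>\<^sub>F x in F. dilate (r x) (f x) \<in> bodies0 \<and>
      ratio_close c (dilate r0 K) (dilate (r x) (f x))"
  proof eventually_elim
    case (elim x)
    have rx: "r x > 0" using elim(1) r0 b by (smt (verit) divide_pos_pos)
    have "r0 < b * r x" using elim(1) b by (simp add: field_simps)
    then have "b * r0 \<le> b * (b * r x)" "b * r x \<le> b * (b * r0)"
      using elim(2) b by auto
    then have le: "r0 * b \<le> c * r x" "r x * b \<le> c * r0"
      unfolding b(2)[symmetric] by (simp_all add: ac_simps)
    have "dilate r0 K \<subseteq> dilate (r0 * b) (f x)"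
      using elim(3) by (intro dilate_trans[OF subset_refl]) (simp add: ratio_close_def)
    also have "\<dots> \<subseteq> dilate (c * r x) (f x)"
      using elim le r0 b by (intro dilate_mono_factor) auto
    finally have 1: "dilate r0 K \<subseteq> dilate c (dilate (r x) (f x))" by (simp add: dilate_dilate)
    have "dilate (r x) (f x) \<subseteq> dilate (r x * b) K"
      using elim(3) by (intro dilate_trans[OF subset_refl]) (simp add: ratio_close_def)
    also have "\<dots> \<subseteq> dilate (c * r0) K"
      using K le rx b by (intro dilate_mono_factor) auto
    finally have 2: "dilate (r x) (f x) \<subseteq> dilate c (dilate r0 K)" by (simp add: dilate_dilate)
    show ?case using 1 2 elim rx by (simp add: ratio_close_def dilate_bodies0)
  qed
qed

text \<open>
  Dilation factors may be decreased along a ray: the form in which star-shapedness about the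
  origin is used to compare intersections of dilates.
\<close>

lemma bodies0_star:
  assumes "K \<in> bodies0" "s *\<^sub>R x \<in> K" "0 \<le> t" "t \<le> s"
  shows "t *\<^sub>R x \<in> K"
proof (cases "s = 0")
  case False
  then have "(t/s) *\<^sub>R (s *\<^sub>R x) + (1 - t/s) *\<^sub>R 0 \<in> K"
    using assms bodies0D[OF assms(1)] by (intro convexD) (auto simp: field_simps)
  then show ?thesis using False by simp
qed (use assms in auto)

context Metric_space
begin

definition dist_to :: "'a set \<Rightarrow> 'a \<Rightarrow> real" where
  "dist_to A z = (INF a\<in>A. d z a)"

lemma dist_to_bdd: "bdd_below ((\<lambda>a. d z a) ` A)"
  by (rule bdd_belowI2[of _ 0]) simp

lemma dist_to_le: "a \<in> A \<Longrightarrow> dist_to A z \<le> d z a"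
  unfolding dist_to_def by (rule cINF_lower[OF dist_to_bdd])

lemma dist_to_Lipschitz:
  assumes "A \<noteq> {}" "A \<subseteq> M" "z \<in> M" "w \<in> M"
  shows "dist_to A z \<le> dist_to A w + d z w"
proof -
  have "dist_to A z - d z w \<le> d w a" if "a \<in> A" for a
    using dist_to_le[OF that, of z] triangle[of z w a] that assms by auto
  then have "dist_to A z - d z w \<le> dist_to A w"
    unfolding dist_to_def[of A w] by (intro cINF_greatest assms(1))
  then show ?thesis by simp
qed

lemma dist_to_pos:
  assumes "A \<noteq> {}" "closedin mtopology A" "z \<in> M" "z \<notin> A"
  shows "0 < dist_to A z"
proof -
  have "openin mtopology (M - A)" using assms(2) by (auto simp: closedin_def)
  then obtain r where r: "r > 0" "mball z r \<subseteq> M - A"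
    using assms(3,4) unfolding openin_mtopology by blast
  have "r \<le> d z a" if "a \<in> A" for a
  proof (rule ccontr)
    assume "\<not> r \<le> d z a"
    then have "a \<in> mball z r" using that assms(3) closedin_subset[OF assms(2)] by auto
    then show False using r(2) that by blast
  qed
  then have "r \<le> dist_to A z" unfolding dist_to_def by (intro cINF_greatest assms(1))
  with r(1) show ?thesis by simp
qed

lemma dist_to_attained:
  assumes "A \<noteq> {}" "b > 1" "0 < dist_to A z"
  obtains a where "a \<in> A" "d z a < b * dist_to A z"
proof -
  have "dist_to A z < b * dist_to A z" using assms by simp
  then obtain a where "a \<in> A" "d z a < b * dist_to A z"
    unfolding dist_to_def[of A z] using cINF_less_iff[OF assms(1) dist_to_bdd] by blast
  then show thesis by (rule that)
qed

text \<open>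
  Hausdorff's formula \<open>inf\<^sub>a (f a + d(z, a) / d(z, A) - 1)\<close> with sums replaced by products and
  infima by intersections. Closedness and convexity of the intersection are automatic; no dilation
  factor is below 1, so a ball common to all \<open>h a\<close> survives in the intersection.
\<close>

definition ratio_extension :: "'a set \<Rightarrow> ('a \<Rightarrow> 'v::euclidean_space set) \<Rightarrow> 'a \<Rightarrow> 'v set" where
  "ratio_extension A h z = (\<Inter>a\<in>A. dilate (d z a / dist_to A z) (h a))"

context
  fixes A :: "'a set" and h :: "'a \<Rightarrow> 'v::euclidean_space set"
  assumes A: "A \<noteq> {}" "closedin mtopology A"
    and h: "\<And>a. a \<in> A \<Longrightarrow> h a \<in> bodies0" "\<And>a. a \<in> A \<Longrightarrow> ball 0 1 \<subseteq> h a"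
begin

lemma dist_to_le_pos:
  assumes "z \<in> M" "z \<notin> A" "a \<in> A"
  shows "0 < dist_to A z" "dist_to A z \<le> d z a" "0 < d z a"
  using dist_to_pos[OF A assms(1,2)] dist_to_le[OF assms(3), of z] by auto

lemma mem_ratio_extension:
  assumes "z \<in> M" "z \<notin> A"
  shows "x \<in> ratio_extension A h z \<longleftrightarrow> (\<forall>a\<in>A. (dist_to A z / d z a) *\<^sub>R x \<in> h a)"
proof -
  have "x \<in> dilate (d z a / dist_to A z) (h a) \<longleftrightarrow> (dist_to A z / d z a) *\<^sub>R x \<in> h a"
    if "a \<in> A" for a
    using mem_dilate_iff[of "d z a / dist_to A z" x "h a"] dist_to_le_pos[OF assms that] by simp
  then show ?thesis unfolding ratio_extension_def by blast
qed

lemma ratio_extension_bodies0: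
  assumes z: "z \<in> M" "z \<notin> A"
  shows "ratio_extension A h z \<in> bodies0"
proof -
  let ?E = "ratio_extension A h z"
  have b: "dilate (d z a / dist_to A z) (h a) \<in> bodies0" if "a \<in> A" for a
    using dilate_bodies0[OF h(1)[OF that], of "d z a / dist_to A z"] dist_to_le_pos[OF z that]
    by simp
  have "compact ?E" unfolding ratio_extension_def
    using A(1) bodies0D(1)[OF b] by (intro compact_Inter) auto
  moreover have "convex ?E" unfolding ratio_extension_def
    using bodies0D(2)[OF b] by (intro convex_INT) auto
  moreover have "ball 0 1 \<subseteq> ?E"
  proof
    fix x :: 'v assume x: "x \<in> ball 0 1"
    have "(dist_to A z / d z a) *\<^sub>R x \<in> h a" if "a \<in> A" for a
    proof (rule bodies0_star[OF h(1)[OF that], of 1])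
      show "1 *\<^sub>R x \<in> h a" using h(2)[OF that] x by auto
      show "0 \<le> dist_to A z / d z a" "dist_to A z / d z a \<le> 1"
        using dist_to_le_pos[OF z that] by auto
    qed
    then show "x \<in> ?E" using mem_ratio_extension[OF z] by blast
  qed
  then have "0 \<in> interior ?E" using interior_maximal[of "ball 0 1" ?E] by auto
  ultimately show ?thesis by (simp add: bodies0_def)
qed

text \<open>
  Away from \<open>A\<close> the distances \<open>d z a\<close> are bounded below by \<open>dist_to A z\<close>, so moving \<open>z\<close>
  slightly changes all of them, and their infimum, by factors near 1 uniformly in \<open>a\<close>. Hence all
  sets in the intersection are rescaled by factors near 1.
\<close>

lemma ratio_extension_near_outside:
  assumes z0: "z0 \<in> M" "z0 \<notin> A" and c: "c > 1"
  obtains \<eta> where "\<eta> > 0"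
    "\<And>z. z \<in> M \<Longrightarrow> d z z0 < \<eta> \<Longrightarrow>
       z \<notin> A \<and> ratio_close c (ratio_extension A h z0) (ratio_extension A h z)"
proof -
  let ?E = "ratio_extension A h"
  have AM: "A \<subseteq> M" using closedin_subset[OF A(2)] by simp
  define b where "b = sqrt c"
  have b: "b > 1" "b * b = c" using c by (auto simp: b_def)
  have cancel_c: "s * (1/c) \<le> t" if "s \<le> c * t" for s t
    using that c by (simp add: field_simps)
  let ?D = "dist_to A z0"
  have D: "?D > 0" using dist_to_pos[OF A z0] .
  \<comment> \<open>An additive error below \<open>(1 - 1/b) t\<close> in \<open>t\<close> is a multiplicative error of at most \<open>b\<close>.\<close>
  define \<eta> where "\<eta> = ?D * (1 - 1/b)"
  have \<eta>: "\<eta> > 0" using D b by (simp add: \<eta>_def)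
  have scale: "t * (1/b) \<le> s \<and> s \<le> b * t" if "?D \<le> t" "\<bar>s - t\<bar> < \<eta>" for s t
  proof -
    have t: "t > 0" using that(1) D by simp
    have "\<eta> \<le> t * (1 - 1/b)" unfolding \<eta>_def using that(1) b by (intro mult_right_mono) auto
    moreover have "t * (1 - 1/b) \<le> t * (b - 1)"
    proof (intro mult_left_mono)
      have "(b - 1)\<^sup>2 \<ge> 0" by simp
      then show "1 - 1/b \<le> b - 1" using b by (simp add: field_simps power2_eq_square)
    qed (use t in simp)
    ultimately have "\<bar>s - t\<bar> < t * (1 - 1/b)" "\<bar>s - t\<bar> < t * (b - 1)"
      using that(2) by linarith+
    then show ?thesis unfolding right_diff_distrib mult.commute[of b t] by linarith
  qed
  have compare: "?E z \<subseteq> dilate c (?E w)"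
    if z: "z \<in> M" "z \<notin> A" and w: "w \<in> M" "w \<notin> A"
      and cmp: "dist_to A w \<le> b * dist_to A z" "\<And>a. a \<in> A \<Longrightarrow> d z a \<le> b * d w a" for z w
  proof
    fix x assume x: "x \<in> ?E z"
    have "(dist_to A w / d w a) *\<^sub>R ((1/c) *\<^sub>R x) \<in> h a" if a: "a \<in> A" for a
    proof -
      note pz = dist_to_le_pos[OF z a] and pw = dist_to_le_pos[OF w a]
      have "d z a / b \<le> d w a" using cmp(2)[OF a] b(1) by (simp add: field_simps)
      then have "dist_to A w / d w a \<le> (b * dist_to A z) / (d z a / b)"
        using cmp(1) pz pw b(1) by (intro frac_le) simp_all
      also have "\<dots> = c * (dist_to A z / d z a)" using b(1) by (simp flip: b(2))
      finally have "(dist_to A w / d w a) * (1/c) \<le> dist_to A z / d z a"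
        by (rule cancel_c)
      moreover have "(dist_to A z / d z a) *\<^sub>R x \<in> h a"
        using x a mem_ratio_extension[OF z] by blast
      moreover have "0 \<le> (dist_to A w / d w a) * (1/c)" using pw c by simp
      ultimately have "((dist_to A w / d w a) * (1/c)) *\<^sub>R x \<in> h a"
        using bodies0_star[OF h(1)[OF a]] by blast
      then show ?thesis by simp
    qed
    then have "(1/c) *\<^sub>R x \<in> ?E w" using mem_ratio_extension[OF w] by blast
    then show "x \<in> dilate c (?E w)" using c by (simp add: mem_dilate_iff)
  qed
  show thesis
  proof
    show "\<eta> > 0" by fact
    fix z assume z: "z \<in> M" "d z z0 < \<eta>"
    have "\<bar>dist_to A z - ?D\<bar> < \<eta>"
      using dist_to_Lipschitz[OF A(1) AM z(1) z0(1)] dist_to_Lipschitz[OF A(1) AM z0(1) z(1)] z(2)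
        commute[of z z0] by linarith
    then have sD: "?D * (1/b) \<le> dist_to A z" "dist_to A z \<le> b * ?D"
      using scale[OF order_refl] by blast+
    have "0 < ?D * (1/b)" using D b(1) by simp
    with sD(1) have "0 < dist_to A z" by linarith
    then have zA: "z \<notin> A" using dist_to_le[of z A z] z(1) by auto
    have sd: "d z0 a * (1/b) \<le> d z a \<and> d z a \<le> b * d z0 a" if a: "a \<in> A" for a
    proof (rule scale)
      show "?D \<le> d z0 a" by (rule dist_to_le[OF a])
      show "\<bar>d z a - d z0 a\<bar> < \<eta>"
      proof -
        have "a \<in> M" using a AM by blast
        then show ?thesis
          using triangle[of z z0 a] triangle[of z0 z a] z z0(1) commute[of z z0] by linarith
      qed
    qed
    have undo: "t \<le> b * s" if "t * (1/b) \<le> s" for s t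
      using that b(1) by (simp add: field_simps)
    have "?E z0 \<subseteq> dilate c (?E z)"
      by (rule compare[OF z0 z(1) zA sD(2)]) (use undo sd in blast)
    moreover have "?E z \<subseteq> dilate c (?E z0)"
      by (rule compare[OF z(1) zA z0 undo[OF sD(1)]]) (use sd in blast)
    ultimately show "z \<notin> A \<and> ratio_close c (?E z0) (?E z)" using zA by (simp add: ratio_close_def)
  qed
qed

text \<open>
  For \<open>z\<close> near \<open>z0 \<in> A\<close>, a point \<open>a\<close> that almost realises the distance from \<open>z\<close> to \<open>A\<close> is
  also near \<open>z0\<close> and bounds the intersection from above by almost \<open>h z0\<close>. From below, points \<open>a\<close>
  near \<open>z0\<close> cut off little because \<open>h a\<close> is close to \<open>h z0\<close>. Points far from \<open>z0\<close> cut off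
  nothing: their factor \<open>d z a / dist_to A z\<close> is so large that already the dilated unit ball
  covers \<open>h z0\<close>.
\<close>

lemma ratio_extension_near_inside:
  assumes z0: "z0 \<in> A" and c: "c > 1"
    and lim: "limitin bodies0_top h (h z0) (atin (subtopology mtopology A) z0)"
  obtains \<eta> where "\<eta> > 0"
    "\<And>a. a \<in> A \<Longrightarrow> d a z0 < \<eta> \<Longrightarrow> ratio_close c (h z0) (h a)"
    "\<And>z. z \<in> M \<Longrightarrow> z \<notin> A \<Longrightarrow> d z z0 < \<eta> \<Longrightarrow> ratio_close c (h z0) (ratio_extension A h z)"
proof -
  let ?E = "ratio_extension A h"
  have AM: "A \<subseteq> M" using closedin_subset[OF A(2)] by simp
  define b where "b = sqrt c"
  have b: "b > 1" "b * b = c" using c by (auto simp: b_def)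
  have bc: "b \<le> c" using b mult_left_mono[of 1 b b] by simp
  have "\<forall>\<^sub>F a in atin_within mtopology z0 A. h a \<in> bodies0 \<and> ratio_close b (h z0) (h a)"
    using lim b(1) by (simp add: limitin_bodies0 atin_subtopology_within[OF z0])
  then obtain \<eta>\<^sub>1 where \<eta>\<^sub>1: "\<eta>\<^sub>1 > 0"
      and near: "\<And>a. a \<in> A \<Longrightarrow> 0 < d a z0 \<Longrightarrow> d a z0 < \<eta>\<^sub>1 \<Longrightarrow> ratio_close b (h z0) (h a)"
    unfolding eventually_atin_within_metric using z0 AM by blast
  have near': "ratio_close b (h z0) (h a)" if "a \<in> A" "d a z0 < \<eta>\<^sub>1" for a
  proof (cases "a = z0")
    case False
    then show ?thesis using near that z0 AM mdist_pos_less[of a z0] by blast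
  qed (use ratio_close_refl[OF h(1)[OF z0]] b in simp)
  obtain S where S: "S > 0" "\<And>x. x \<in> h z0 \<Longrightarrow> norm x \<le> S"
    using bodies0D(6)[OF h(1)[OF z0]] by (auto simp: bounded_pos)
  \<comment> \<open>The summand \<open>S\<close> makes far points harmless (second case below), and \<open>b\<close> keeps the almost
    nearest point within \<open>\<eta>\<^sub>1\<close> of \<open>z0\<close>.\<close>
  define \<eta> where "\<eta> = \<eta>\<^sub>1 / (S + b + 1)"
  have S1: "S + b + 1 > 0" using S b by simp
  have \<eta>: "\<eta> > 0" "\<eta> * (S + b + 1) = \<eta>\<^sub>1" using \<eta>\<^sub>1 S1 by (auto simp: \<eta>_def)
  have "\<eta> * S > 0" "\<eta> * b > 0" using \<eta> S b by auto
  then have \<eta>': "\<eta> * (S + 1) < \<eta>\<^sub>1" "\<eta> * (b + 1) < \<eta>\<^sub>1"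
    using \<eta>(2) by (auto simp: algebra_simps)
  show thesis
  proof
    show "\<eta> > 0" by fact
    show "ratio_close c (h z0) (h a)" if "a \<in> A" "d a z0 < \<eta>" for a
    proof -
      have "d a z0 < \<eta>\<^sub>1" using that \<eta>' \<open>\<eta> * S > 0\<close> by (simp add: algebra_simps)
      then show ?thesis
        using ratio_close_mono[OF near'] that h z0 b bc by simp
    qed
    fix z assume z: "z \<in> M" "z \<notin> A" and dz: "d z z0 < \<eta>"
    have Dz: "0 < dist_to A z" "dist_to A z < \<eta>"
      using dist_to_le_pos[OF z z0] dz by auto
    have "h z0 \<subseteq> dilate c (?E z)"
    proof
      fix x assume x: "x \<in> h z0"
      have "(dist_to A z / d z a) *\<^sub>R ((1/c) *\<^sub>R x) \<in> h a" if a: "a \<in> A" for a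
      proof (cases "d a z0 < \<eta>\<^sub>1")
        case True
        then have "(1/b) *\<^sub>R x \<in> h a"
          using near'[OF a] x b mem_dilate_iff[of b x "h a"] by (auto simp: ratio_close_def)
        moreover have "(dist_to A z / d z a) * (1/c) \<le> 1 * (1/b)"
          using dist_to_le_pos[OF z a] b bc by (intro mult_mono) (auto simp: field_simps)
        moreover have "0 \<le> (dist_to A z / d z a) * (1/c)"
          using dist_to_le_pos[OF z a] c by simp
        ultimately have "((dist_to A z / d z a) * (1/c)) *\<^sub>R x \<in> h a"
          using bodies0_star[OF h(1)[OF a]] by (metis mult_1)
        then show ?thesis by simp
      next
        case False
        have "\<eta>\<^sub>1 \<le> d z a + \<eta>"
          using False triangle[of a z z0] subsetD[OF AM a] subsetD[OF AM z0] z dz commute[of a z]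
          by linarith
        then have "\<eta> * S < d z a" using \<eta>'(1) by (simp add: algebra_simps)
        moreover have "dist_to A z * S \<le> \<eta> * S" using Dz S by simp
        ultimately have "dist_to A z * S < d z a" by simp
        moreover have "dist_to A z * norm x \<le> dist_to A z * S"
          using S(2)[OF x] Dz by simp
        ultimately have "dist_to A z * norm x < d z a" by simp
        then have "(dist_to A z / d z a) *\<^sub>R x \<in> ball 0 1"
          using dist_to_le_pos[OF z a] by (simp add: field_simps)
        then have "(dist_to A z / d z a) *\<^sub>R x \<in> h a" using h(2)[OF a] by blast
        moreover have "(dist_to A z / d z a) * (1/c) \<le> dist_to A z / d z a"
          using dist_to_le_pos[OF z a] c by (intro mult_right_le_one_le) auto
        moreover have "0 \<le> (dist_to A z / d z a) * (1/c)"
          using dist_to_le_pos[OF z a] c by simp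
        ultimately have "((dist_to A z / d z a) * (1/c)) *\<^sub>R x \<in> h a"
          using bodies0_star[OF h(1)[OF a]] by (metis mult_1)
        then show ?thesis by simp
      qed
      then have "(1/c) *\<^sub>R x \<in> ?E z" using mem_ratio_extension[OF z] by blast
      then show "x \<in> dilate c (?E z)" using c by (simp add: mem_dilate_iff)
    qed
    moreover have "?E z \<subseteq> dilate c (h z0)"
    proof
      fix x assume x: "x \<in> ?E z"
      obtain a where a: "a \<in> A" "d z a < b * dist_to A z"
        using dist_to_attained[OF A(1) b(1) Dz(1)] .
      have "d a z0 \<le> d z a + d z z0"
        using triangle[of a z z0] subsetD[OF AM a(1)] subsetD[OF AM z0] z commute[of a z] by simp
      also have "\<dots> < b * \<eta> + \<eta>"
      proof (intro add_strict_mono dz)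
        have "b * dist_to A z \<le> b * \<eta>" using Dz b by simp
        with a(2) show "d z a < b * \<eta>" by simp
      qed
      also have "\<dots> < \<eta>\<^sub>1" using \<eta>'(2) by (simp add: algebra_simps)
      finally have "ratio_close b (h z0) (h a)" using near' a(1) by blast
      moreover have "(1/b) *\<^sub>R x \<in> h a"
      proof (rule bodies0_star[OF h(1)[OF a(1)]])
        show "(dist_to A z / d z a) *\<^sub>R x \<in> h a" using x a(1) mem_ratio_extension[OF z] by blast
        show "1/b \<le> dist_to A z / d z a"
          using a(2) dist_to_le_pos[OF z a(1)] b by (simp add: field_simps)
      qed (use b in simp)
      ultimately have "(1/b) *\<^sub>R x \<in> dilate b (h z0)" by (auto simp: ratio_close_def)
      then have "(1/c) *\<^sub>R x \<in> h z0" using b(1) by (simp add: mem_dilate_iff flip: b(2))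
      then show "x \<in> dilate c (h z0)" using c by (simp add: mem_dilate_iff)
    qed
    ultimately show "ratio_close c (h z0) (?E z)" by (simp add: ratio_close_def)
  qed
qed

text \<open>
  On \<open>A\<close> the formula degenerates to division by zero, so the given values are put in by hand.
\<close>

lemma continuous_map_ratio_extension:
  assumes cont: "continuous_map (subtopology mtopology A) bodies0_top h"
  shows "continuous_map mtopology bodies0_top (\<lambda>z. if z \<in> A then h z else ratio_extension A h z)"
    (is "continuous_map _ _ ?g")
  unfolding continuous_map_atin limitin_bodies0 eventually_atin_metric
proof (intro ballI conjI allI impI)
  have AM: "A \<subseteq> M" using closedin_subset[OF A(2)] by simp
  have g: "?g z \<in> bodies0" if "z \<in> M" for z
    using that h(1) ratio_extension_bodies0 by simp
  fix z0 assume z0: "z0 \<in> topspace mtopology"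
  then show "?g z0 \<in> bodies0" using g by simp
  fix c :: real assume c: "c > 1"
  have "\<exists>\<eta>>0. \<forall>z\<in>M. d z z0 < \<eta> \<longrightarrow> ratio_close c (?g z0) (?g z)"
  proof (cases "z0 \<in> A")
    case True
    then have "limitin bodies0_top h (h z0) (atin (subtopology mtopology A) z0)"
      using cont AM by (intro limitin_continuous_map[OF cont]) auto
    from ratio_extension_near_inside[OF True c this]
    obtain \<eta> where "\<eta> > 0"
      "\<And>a. a \<in> A \<Longrightarrow> d a z0 < \<eta> \<Longrightarrow> ratio_close c (h z0) (h a)"
      "\<And>z. z \<in> M \<Longrightarrow> z \<notin> A \<Longrightarrow> d z z0 < \<eta> \<Longrightarrow> ratio_close c (h z0) (ratio_extension A h z)"
      by blast
    with True show ?thesis by (intro exI[of _ \<eta>]) auto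
  next
    case False
    from ratio_extension_near_outside[OF _ False c] z0
    obtain \<eta> where "\<eta> > 0"
      "\<And>z. z \<in> M \<Longrightarrow> d z z0 < \<eta> \<Longrightarrow>
         z \<notin> A \<and> ratio_close c (ratio_extension A h z0) (ratio_extension A h z)"
      by auto
    with False show ?thesis by (intro exI[of _ \<eta>]) auto
  qed
  then show "\<exists>\<eta>>0. \<forall>z. z \<in> M \<and> 0 < d z z0 \<and> d z z0 < \<eta> \<longrightarrow> ?g z \<in> bodies0 \<and> ratio_close c (?g z0) (?g z)"
    using g by blast
qed

end

end

text \<open>
  Dividing by the inradius makes all bodies contain the unit ball, as the intersection formula
  requires; the extended inradius, kept positive by Tietze's theorem on \<open>(0, \<infinity>)\<close>, restores the
  size afterwards.
\<close>

theorem continuous_bodies0_extension: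
  fixes f :: "'z \<Rightarrow> 'a::euclidean_space set"
  assumes Z: "metrizable_space Z" and A: "closedin Z A" "A \<noteq> {}"
    and f: "continuous_map (subtopology Z A) bodies0_top f"
  obtains g where "continuous_map Z bodies0_top g" "\<And>a. a \<in> A \<Longrightarrow> g a = f a"
proof -
  obtain M d where "Metric_space M d" and ZM: "Z = Metric_space.mtopology M d"
    using Z by (auto simp: metrizable_space_def)
  interpret Metric_space M d by fact
  have top: "topspace (subtopology Z A) = A"
    using closedin_subset[OF A(1)] by auto
  have fb: "f a \<in> bodies0" if "a \<in> A" for a
    using continuous_map_image_subset_topspace[OF f] that top by auto
  have flim: "limitin bodies0_top f (f a) (atin (subtopology Z A) a)" if "a \<in> A" for a
    using f that top by (simp add: continuous_map_atin)
  have "continuous_map (subtopology Z A) euclideanreal (\<lambda>a. inradius (f a))"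
    unfolding continuous_map_atin top using tendsto_inradius[OF flim] by simp
  then obtain R where R: "continuous_map Z euclideanreal R" "R ` topspace Z \<subseteq> {0<..}"
      "\<And>a. a \<in> A \<Longrightarrow> R a = inradius (f a)"
    using Tietze_extension_realinterval[OF metrizable_imp_normal_space[OF Z] A(1), of "{0<..}"]
      inradius_pos[OF fb] by (auto simp: is_interval_def image_subset_iff)
  have Rpos: "R a > 0" if "a \<in> A" for a using R(3)[OF that] inradius_pos[OF fb[OF that]] by simp
  define h where "h a = dilate (1 / R a) (f a)" for a
  have hb: "h a \<in> bodies0" if "a \<in> A" for a
    unfolding h_def using Rpos fb that by (intro dilate_bodies0) auto
  have hball: "ball 0 1 \<subseteq> h a" if "a \<in> A" for a
  proof
    fix x :: 'a assume "x \<in> ball 0 1"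
    then have "R a *\<^sub>R x \<in> ball 0 (inradius (f a))"
      using Rpos[OF that] R(3)[OF that] by simp
    then have "R a *\<^sub>R x \<in> f a" using ball_inradius by blast
    then show "x \<in> h a" using Rpos[OF that] by (simp add: h_def mem_dilate_iff)
  qed
  have "limitin bodies0_top h (h a) (atin (subtopology Z A) a)" if "a \<in> A" for a
    unfolding h_def
  proof (rule limitin_dilate[OF flim[OF that]])
    have "continuous_map (subtopology Z A) euclideanreal R"
      by (rule continuous_map_from_subtopology[OF R(1)])
    then have "(R \<longlongrightarrow> R a) (atin (subtopology Z A) a)"
      using that top by (simp add: continuous_map_atin)
    then show "((\<lambda>x. 1 / R x) \<longlongrightarrow> 1 / R a) (atin (subtopology Z A) a)"
      using Rpos[OF that] by (intro tendsto_divide tendsto_const) auto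
  qed (use Rpos[OF that] in simp)
  then have "continuous_map (subtopology Z A) bodies0_top h"
    unfolding continuous_map_atin top by blast
  then have E: "continuous_map Z bodies0_top (\<lambda>z. if z \<in> A then h z else ratio_extension A h z)"
    using A(1) hb hball unfolding ZM by (intro continuous_map_ratio_extension[OF A(2)])
  let ?E = "\<lambda>z. if z \<in> A then h z else ratio_extension A h z"
  show thesis
  proof
    show "continuous_map Z bodies0_top (\<lambda>z. dilate (R z) (?E z))"
      unfolding continuous_map_atin
    proof
      fix z assume z: "z \<in> topspace Z"
      show "limitin bodies0_top (\<lambda>z. dilate (R z) (?E z)) (dilate (R z) (?E z)) (atin Z z)"
      proof (rule limitin_dilate)
        show "limitin bodies0_top ?E (?E z) (atin Z z)"
          using E z unfolding continuous_map_atin by blast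
        show "(R \<longlongrightarrow> R z) (atin Z z)" using R(1) z by (simp add: continuous_map_atin)
        show "R z > 0" using R(2) z by auto
      qed
    qed
    show "dilate (R a) (?E a) = f a" if "a \<in> A" for a
      using that Rpos[OF that] by (simp add: h_def dilate_dilate)
  qed
qed

section \<open>Equivariant retractions\<close>

text \<open>
  The mean symmetrises an arbitrary extension \<open>g\<close> of the inverse embedding: on \<open>A\<close> the two
  arguments of the mean coincide because \<open>g\<close> is equivariant there, and elsewhere \<open>\<beta>\<close> swaps
  them up to \<open>\<alpha>\<close>.
\<close>

lemma (in order_reversing_involution) Z2_AR_bodies0: "Z2_AR TYPE('z) bodies0_top \<alpha>"
  unfolding Z2_AR_def
proof (intro conjI allI impI metrizable_space_bodies0 involution)
  fix Z :: "'z topology" and \<beta> A and e :: "'a set \<Rightarrow> 'z"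
  assume *: "metrizable_space Z \<and> involution_on Z \<beta> \<and> closedin Z A \<and> \<beta> ` A = A \<and>
    homeomorphic_map bodies0_top (subtopology Z A) e \<and>
    equivariant_on (topspace bodies0_top) \<alpha> \<beta> e"
  then have Z: "metrizable_space Z" and \<beta>: "continuous_map Z Z \<beta>" "\<And>z. z \<in> topspace Z \<Longrightarrow> \<beta> (\<beta> z) = z"
    and A: "closedin Z A" and \<beta>A: "\<beta> ` A = A" and eq: "\<And>K. K \<in> bodies0 \<Longrightarrow> e (\<alpha> K) = \<beta> (e K)"
    by (auto simp: involution_on_def equivariant_on_def)
  have AZ: "A \<subseteq> topspace Z" and top: "topspace (subtopology Z A) = A"
    using closedin_subset[OF A] by auto
  obtain e' where e: "continuous_map bodies0_top (subtopology Z A) e"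
      and e': "continuous_map (subtopology Z A) bodies0_top e'"
      and inv: "\<And>K. K \<in> bodies0 \<Longrightarrow> e' (e K) = K" "\<And>a. a \<in> A \<Longrightarrow> e (e' a) = a"
    using * top unfolding homeomorphic_map_maps homeomorphic_maps_def by auto
  have eA: "e K \<in> A" if "K \<in> bodies0" for K
    using continuous_map_image_subset_topspace[OF e] that top by auto
  have e'b: "e' a \<in> bodies0" if "a \<in> A" for a
    using continuous_map_image_subset_topspace[OF e'] that top by auto
  have "bodies0 \<noteq> ({} :: 'a set set)"
  proof -
    have "cball 0 1 \<in> (bodies0 :: 'a set set)" by (simp add: bodies0_def)
    then show ?thesis by blast
  qed
  then have "A \<noteq> {}" using eA by blast
  then obtain g where g: "continuous_map Z bodies0_top g" "\<And>a. a \<in> A \<Longrightarrow> g a = e' a"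
    using continuous_bodies0_extension[OF Z A _ e'] by blast
  have \<beta>Z: "\<beta> z \<in> topspace Z" if "z \<in> topspace Z" for z
    using continuous_map_image_subset_topspace[OF \<beta>(1)] that by auto
  have gb: "g z \<in> bodies0" if "z \<in> topspace Z" for z
    using continuous_map_image_subset_topspace[OF g(1)] that by auto
  define F where "F z = dual_mean (g z) (\<alpha> (g (\<beta> z)))" for z
  have Fb: "F z \<in> bodies0" if "z \<in> topspace Z" for z
    unfolding F_def using that by (intro dual_mean_bodies0 alpha_bodies0 gb \<beta>Z)
  have F: "continuous_map Z bodies0_top F"
    unfolding continuous_map_atin F_def
  proof (intro ballI limitin_dual_mean limitin_alpha)
    fix z assume z: "z \<in> topspace Z"
    show "limitin bodies0_top g (g z) (atin Z z)"
      using z g(1) by (simp add: continuous_map_atin)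
    show "limitin bodies0_top (\<lambda>z. g (\<beta> z)) (g (\<beta> z)) (atin Z z)"
      using continuous_map_compose[OF \<beta>(1) g(1)] z by (simp add: continuous_map_atin o_def)
  qed
  have F_equi: "F (\<beta> z) = \<alpha> (F z)" if z: "z \<in> topspace Z" for z
  proof -
    have b: "g z \<in> bodies0" "g (\<beta> z) \<in> bodies0" using gb \<beta>Z z by auto
    have "\<alpha> (F z) = dual_mean (\<alpha> (g z)) (\<alpha> (\<alpha> (g (\<beta> z))))"
      unfolding F_def using b by (intro dual_mean_alpha[symmetric] alpha_bodies0)
    also have "\<dots> = dual_mean (g (\<beta> z)) (\<alpha> (g z))"
      using alpha_alpha[OF b(2)] squeeze_commute[OF alpha_bodies0[OF b(1)] b(2)]
      by (simp add: dual_mean_def)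
    finally show ?thesis using \<beta>(2)[OF z] by (simp add: F_def)
  qed
  show "\<exists>r. continuous_map Z (subtopology Z A) r \<and> (\<forall>x\<in>A. r x = x) \<and>
      equivariant_on (topspace Z) \<beta> \<beta> r"
  proof (intro exI[of _ "e \<circ> F"] conjI ballI)
    show "continuous_map Z (subtopology Z A) (e \<circ> F)"
      by (rule continuous_map_compose[OF F e])
    show "(e \<circ> F) a = a" if a: "a \<in> A" for a
    proof -
      have "\<beta> a = e (\<alpha> (e' a))" using eq[OF e'b[OF a]] inv(2)[OF a] by simp
      moreover have "\<beta> a \<in> A" using \<beta>A a by blast
      ultimately have "g (\<beta> a) = \<alpha> (e' a)"
        using g(2) inv(1)[OF alpha_bodies0[OF e'b[OF a]]] by simp
      then have "F a = e' a"
        unfolding F_def using g(2)[OF a] alpha_alpha[OF e'b[OF a]] dual_mean_self[OF e'b[OF a]] by simp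
      then show ?thesis using inv(2)[OF a] by simp
    qed
    show "equivariant_on (topspace Z) \<beta> \<beta> (e \<circ> F)"
      unfolding equivariant_on_def using F_equi eq Fb by simp
  qed
qed

theorem theorem5p1:
  fixes \<alpha> :: "(real ^ 'n) set \<Rightarrow> (real ^ 'n) set"
  assumes "CARD('n) \<ge> 2"
    and "involution_on bodies0_top \<alpha>"
    and "antimono_on bodies0 \<alpha>"
  shows "(\<exists>p. equivariant_mean_on bodies0_top \<alpha> p) \<and> Z2_AR TYPE('z) bodies0_top \<alpha>"
proof -
  interpret order_reversing_involution \<alpha> by unfold_locales fact+
  show ?thesis using equivariant_mean Z2_AR_bodies0 by blast
qed

end
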